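(* Suppose that $q\in\Omega_{\xi_0,\eta_0}^{0,T}$ is an $\Omega_{\xi_0,\eta_0}^{0,T}$-local minimizer of $J$ and let $[a,b]\subset[0,T]$ with $a<b$. Then the restricted curve $q|_{[a,b]}$ is an $\Omega_{\xi,\eta}^{a,b}$-local minimizer of $J$, where $\xi=(q(a),\dot q(a))$ and $\eta=(q(b),\dot q(b))$ in $TQ$.
   Context: $Q$ is a complete connected Riemannian manifold, $\frac{D}{dt}$ is the covariant derivative along a curve for the Levi-Civita connection, and $V:Q\to\mathbb{R}$ is smooth and non-negative. $T>0$ and $\xi_0,\eta_0\in TQ$ are fixed. For $a<b$ and $\xi=(q_a,v_a),\eta=(q_b,v_b)\in TQ$, $\Omega_{\xi,\eta}^{a,b}$ is the set of piecewise smooth $C^1$ curves $\gamma:[a,b]\to Q$ with $\gamma(a)=q_a$, $\dot\gamma(a)=v_a$, $\gamma(b)=q_b$, $\dot\gamma(b)=v_b$. On $\Omega_{\xi,\eta}^{a,b}$ the functional $J$ is $J(\gamma)=\int_a^b\big(\tfrac12\|\tfrac{D}{dt}\dot\gamma(t)\|^2+V(\gamma(t))\big)dt$ (the limits of integration always match the interval of the admissible set). A curve $\gamma\in\Omega_{\xi,\eta}^{a,b}$ is an $\Omega_{\xi,\eta}^{a,b}$-local minimizer of $J$ if $J(\gamma)\le J(\tilde\gamma)$ for all $\tilde\gamma$ in some $C^1$ neighborhood of $\gamma$ within $\Omega_{\xi,\eta}^{a,b}$. *)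

theory Defs
  imports "HOL-Analysis.Analysis"
begin

text \<open>
  \<open>Ck_on\<close> is meant for open subsets of a Euclidean space and for relatively open subsets of a
  nondegenerate interval (where derivatives at the endpoints are one-sided); on such sets
  derivatives within the set are unique.
\<close>

primrec Ck_on :: "nat \<Rightarrow> 'a::real_normed_vector set \<Rightarrow> ('a \<Rightarrow> 'b::real_normed_vector) \<Rightarrow> bool" where
  "Ck_on 0 S f \<longleftrightarrow> continuous_on S f"
| "Ck_on (Suc k) S f \<longleftrightarrow>
     f differentiable_on S \<and> (\<forall>v. Ck_on k S (\<lambda>x. frechet_derivative f (at x within S) v))"

definition smooth_on :: "'a::real_normed_vector set \<Rightarrow> ('a \<Rightarrow> 'b::real_normed_vector) \<Rightarrow> bool" where
  "smooth_on S f \<longleftrightarrow> (\<forall>k. Ck_on k S f)"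


section \<open>Smooth manifolds\<close>

text \<open>
  The underlying space of a manifold is the whole type \<open>'q\<close>. A chart \<open>(U, \<phi>)\<close> consists of its
  domain and the coordinate map; the values of \<open>\<phi>\<close> outside \<open>U\<close> are irrelevant. The smooth structure
  is given by an atlas, which need not be maximal.
\<close>

type_synonym ('q, 'e) chart = "'q set \<times> ('q \<Rightarrow> 'e)"

definition is_chart :: "('q::topological_space, 'e::euclidean_space) chart \<Rightarrow> bool" where
  "is_chart = (\<lambda>(U, \<phi>). open U \<and> open (\<phi> ` U) \<and> homeomorphism U (\<phi> ` U) \<phi> (inv_into U \<phi>))"

definition transition :: "('q, 'e) chart \<Rightarrow> ('q, 'e) chart \<Rightarrow> 'e \<Rightarrow> 'e" where
  "transition = (\<lambda>(U, \<phi>) (U', \<phi>'). \<phi>' \<circ> inv_into U \<phi>)"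

definition smooth_atlas :: "('q::topological_space, 'e::euclidean_space) chart set \<Rightarrow> bool" where
  "smooth_atlas A \<longleftrightarrow>
     (\<forall>c\<in>A. is_chart c) \<and> (\<Union>c\<in>A. fst c) = UNIV \<and>
     (\<forall>c\<in>A. \<forall>c'\<in>A. smooth_on (snd c ` (fst c \<inter> fst c')) (transition c c'))"

definition smooth_function ::
    "('q, 'e::euclidean_space) chart set \<Rightarrow> ('q \<Rightarrow> real) \<Rightarrow> bool" where
  "smooth_function A f \<longleftrightarrow> (\<forall>(U, \<phi>)\<in>A. smooth_on (\<phi> ` U) (f \<circ> inv_into U \<phi>))"

text \<open>
  A tangent vector at \<open>p\<close> is the family of its coordinate representations in all charts around \<open>p\<close>,
  related by the derivatives of the transition maps. The value \<open>0\<close> for all other charts makes equality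
  of tangent vectors coincide with equality of functions.
\<close>

type_synonym ('q, 'e) tangent = "('q, 'e) chart \<Rightarrow> 'e"

definition tangent_space ::
    "('q, 'e::euclidean_space) chart set \<Rightarrow> 'q \<Rightarrow> ('q, 'e) tangent set" where
  "tangent_space A p = {v.
     (\<forall>c. c \<notin> A \<or> p \<notin> fst c \<longrightarrow> v c = 0) \<and>
     (\<forall>c\<in>A. \<forall>c'\<in>A. p \<in> fst c \<inter> fst c' \<longrightarrow>
        v c' = frechet_derivative (transition c c') (at (snd c p)) (v c))}"

definition tangent_bundle ::
    "('q, 'e::euclidean_space) chart set \<Rightarrow> ('q \<times> ('q, 'e) tangent) set" where
  "tangent_bundle A = Sigma UNIV (tangent_space A)"

text \<open>The tangent vector at \<open>p\<close> whose representation in the chart \<open>c\<close> around \<open>p\<close> is \<open>u\<close>:\<close>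

definition coord_vector ::
    "('q, 'e::euclidean_space) chart set \<Rightarrow> ('q, 'e) chart \<Rightarrow> 'q \<Rightarrow> 'e \<Rightarrow> ('q, 'e) tangent" where
  "coord_vector A c p u = (\<lambda>c'.
     if c' \<in> A \<and> p \<in> fst c' then frechet_derivative (transition c c') (at (snd c p)) u else 0)"


section \<open>Curves\<close>

text \<open>
  A curve on \<open>{a..b}\<close> is a function on the reals of which only the values on \<open>{a..b}\<close> matter;
  its velocity is one-sided at the endpoints.
\<close>

definition Ck_curve ::
    "('q::topological_space, 'e::euclidean_space) chart set \<Rightarrow> nat \<Rightarrow> real \<Rightarrow> real \<Rightarrow> (real \<Rightarrow> 'q) \<Rightarrow> bool" where
  "Ck_curve A k a b \<gamma> \<longleftrightarrow>
     continuous_on {a..b} \<gamma> \<and> (\<forall>(U, \<phi>)\<in>A. Ck_on k ({a..b} \<inter> \<gamma> -` U) (\<phi> \<circ> \<gamma>))"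

text \<open>The finite set \<open>P\<close> contains the break points of the curve.\<close>

definition piecewise_smooth_curve ::
    "('q::topological_space, 'e::euclidean_space) chart set \<Rightarrow> real \<Rightarrow> real \<Rightarrow> (real \<Rightarrow> 'q) \<Rightarrow> bool" where
  "piecewise_smooth_curve A a b \<gamma> \<longleftrightarrow>
     continuous_on {a..b} \<gamma> \<and>
     (\<exists>P. finite P \<and> (\<forall>c d. a \<le> c \<and> c < d \<and> d \<le> b \<and> {c<..<d} \<inter> P = {} \<longrightarrow>
        (\<forall>k. Ck_curve A k c d \<gamma>)))"

definition velocity ::
    "('q, 'e::euclidean_space) chart set \<Rightarrow> real \<Rightarrow> real \<Rightarrow> (real \<Rightarrow> 'q) \<Rightarrow> real \<Rightarrow> ('q, 'e) tangent" where
  "velocity A a b \<gamma> t = (\<lambda>(U, \<phi>).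
     if (U, \<phi>) \<in> A \<and> \<gamma> t \<in> U then vector_derivative (\<phi> \<circ> \<gamma>) (at t within {a..b}) else 0)"


section \<open>Riemannian metrics\<close>

definition local_metric ::
    "('q, 'e::euclidean_space) chart set \<Rightarrow> ('q \<Rightarrow> ('q, 'e) tangent \<Rightarrow> ('q, 'e) tangent \<Rightarrow> real) \<Rightarrow>
     ('q, 'e) chart \<Rightarrow> 'e \<Rightarrow> 'e \<Rightarrow> 'e \<Rightarrow> real" where
  "local_metric A g c x u w =
     (let p = inv_into (fst c) (snd c) x in g p (coord_vector A c p u) (coord_vector A c p w))"

definition riemannian_metric ::
    "('q, 'e::euclidean_space) chart set \<Rightarrow>
     ('q \<Rightarrow> ('q, 'e) tangent \<Rightarrow> ('q, 'e) tangent \<Rightarrow> real) \<Rightarrow> bool" where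
  "riemannian_metric A g \<longleftrightarrow>
     (\<forall>p. \<forall>u\<in>tangent_space A p. \<forall>v\<in>tangent_space A p. \<forall>w\<in>tangent_space A p. \<forall>r s.
        g p (\<lambda>c. r *\<^sub>R u c + s *\<^sub>R v c) w = r * g p u w + s * g p v w) \<and>
     (\<forall>p. \<forall>v\<in>tangent_space A p. \<forall>w\<in>tangent_space A p. g p v w = g p w v) \<and>
     (\<forall>p. \<forall>v\<in>tangent_space A p. v \<noteq> (\<lambda>c. 0) \<longrightarrow> 0 < g p v v) \<and>
     (\<forall>c\<in>A. \<forall>u w. smooth_on (snd c ` fst c) (\<lambda>x. local_metric A g c x u w))"

definition metric_norm ::
    "('q \<Rightarrow> ('q, 'e) tangent \<Rightarrow> ('q, 'e) tangent \<Rightarrow> real) \<Rightarrow> 'q \<Rightarrow> ('q, 'e) tangent \<Rightarrow> real" where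
  "metric_norm g p v = sqrt (g p v v)"

definition curve_length ::
    "('q, 'e::euclidean_space) chart set \<Rightarrow> ('q \<Rightarrow> ('q, 'e) tangent \<Rightarrow> ('q, 'e) tangent \<Rightarrow> real) \<Rightarrow>
     real \<Rightarrow> real \<Rightarrow> (real \<Rightarrow> 'q) \<Rightarrow> real" where
  "curve_length A g a b \<gamma> = integral {a..b} (\<lambda>t. metric_norm g (\<gamma> t) (velocity A a b \<gamma> t))"

definition riemannian_distance ::
    "('q::topological_space, 'e::euclidean_space) chart set \<Rightarrow>
     ('q \<Rightarrow> ('q, 'e) tangent \<Rightarrow> ('q, 'e) tangent \<Rightarrow> real) \<Rightarrow> 'q \<Rightarrow> 'q \<Rightarrow> real" where
  "riemannian_distance A g p p' =
     Inf {curve_length A g 0 1 \<gamma> | \<gamma>. piecewise_smooth_curve A 0 1 \<gamma> \<and> \<gamma> 0 = p \<and> \<gamma> 1 = p'}"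

definition complete_connected_riemannian_manifold ::
    "('q::{t2_space,second_countable_topology}, 'e::euclidean_space) chart set \<Rightarrow>
     ('q \<Rightarrow> ('q, 'e) tangent \<Rightarrow> ('q, 'e) tangent \<Rightarrow> real) \<Rightarrow> bool" where
  "complete_connected_riemannian_manifold A g \<longleftrightarrow>
     smooth_atlas A \<and> riemannian_metric A g \<and> connected (UNIV :: 'q set) \<and>
     Metric_space.mcomplete UNIV (riemannian_distance A g)"


section \<open>The Levi-Civita connection\<close>

text \<open>
  A connection is given by its Christoffel maps: \<open>\<Gamma> c x u w\<close> is the representation in the chart \<open>c\<close>,
  at the point with coordinates \<open>x\<close>, of the derivative in direction \<open>u\<close> of the field which is constantly
  \<open>w\<close> in these coordinates. With \<open>\<tau>\<close> the change of coordinates from \<open>c\<close> to \<open>c'\<close>, the last condition is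
  the transformation law that makes the local operators
  \<open>W \<mapsto> DW(x) u + \<Gamma> c x u (W x)\<close> agree on overlaps.
\<close>

definition affine_connection ::
    "('q, 'e::euclidean_space) chart set \<Rightarrow> (('q, 'e) chart \<Rightarrow> 'e \<Rightarrow> 'e \<Rightarrow> 'e \<Rightarrow> 'e) \<Rightarrow> bool" where
  "affine_connection A \<Gamma> \<longleftrightarrow>
     (\<forall>c\<in>A. \<forall>x\<in>snd c ` fst c. bilinear (\<Gamma> c x)) \<and>
     (\<forall>c\<in>A. \<forall>u w. smooth_on (snd c ` fst c) (\<lambda>x. \<Gamma> c x u w)) \<and>
     (\<forall>c\<in>A. \<forall>c'\<in>A. \<forall>x\<in>snd c ` (fst c \<inter> fst c'). \<forall>u w.
        let \<tau> = transition c c'; D\<tau> = (\<lambda>y. frechet_derivative \<tau> (at y)) in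
        D\<tau> x (\<Gamma> c x u w) =
          frechet_derivative (\<lambda>y. D\<tau> y w) (at x) u + \<Gamma> c' (\<tau> x) (D\<tau> x u) (D\<tau> x w))"

definition torsion_free ::
    "('q, 'e::euclidean_space) chart set \<Rightarrow> (('q, 'e) chart \<Rightarrow> 'e \<Rightarrow> 'e \<Rightarrow> 'e \<Rightarrow> 'e) \<Rightarrow> bool" where
  "torsion_free A \<Gamma> \<longleftrightarrow> (\<forall>c\<in>A. \<forall>x\<in>snd c ` fst c. \<forall>u w. \<Gamma> c x u w = \<Gamma> c x w u)"

definition metric_compatible ::
    "('q, 'e::euclidean_space) chart set \<Rightarrow> ('q \<Rightarrow> ('q, 'e) tangent \<Rightarrow> ('q, 'e) tangent \<Rightarrow> real) \<Rightarrow>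
     (('q, 'e) chart \<Rightarrow> 'e \<Rightarrow> 'e \<Rightarrow> 'e \<Rightarrow> 'e) \<Rightarrow> bool" where
  "metric_compatible A g \<Gamma> \<longleftrightarrow>
     (\<forall>c\<in>A. \<forall>x\<in>snd c ` fst c. \<forall>u w z.
        frechet_derivative (\<lambda>y. local_metric A g c y w z) (at x) u =
          local_metric A g c x (\<Gamma> c x u w) z + local_metric A g c x w (\<Gamma> c x u z))"

definition levi_civita_connection ::
    "('q, 'e::euclidean_space) chart set \<Rightarrow> ('q \<Rightarrow> ('q, 'e) tangent \<Rightarrow> ('q, 'e) tangent \<Rightarrow> real) \<Rightarrow>
     (('q, 'e) chart \<Rightarrow> 'e \<Rightarrow> 'e \<Rightarrow> 'e \<Rightarrow> 'e) \<Rightarrow> bool" where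
  "levi_civita_connection A g \<Gamma> \<longleftrightarrow>
     affine_connection A \<Gamma> \<and> torsion_free A \<Gamma> \<and> metric_compatible A g \<Gamma>"

text \<open>Covariant derivative along \<open>\<gamma>\<close> of a vector field \<open>X\<close> along \<open>\<gamma>\<close>, where \<open>X t\<close> is tangent at \<open>\<gamma> t\<close>:\<close>

definition covariant_derivative ::
    "('q, 'e::euclidean_space) chart set \<Rightarrow> (('q, 'e) chart \<Rightarrow> 'e \<Rightarrow> 'e \<Rightarrow> 'e \<Rightarrow> 'e) \<Rightarrow>
     real \<Rightarrow> real \<Rightarrow> (real \<Rightarrow> 'q) \<Rightarrow> (real \<Rightarrow> ('q, 'e) tangent) \<Rightarrow> real \<Rightarrow> ('q, 'e) tangent" where
  "covariant_derivative A \<Gamma> a b \<gamma> X t = (\<lambda>(U, \<phi>).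
     if (U, \<phi>) \<in> A \<and> \<gamma> t \<in> U
     then vector_derivative (\<lambda>s. X s (U, \<phi>)) (at t within {a..b}) +
          \<Gamma> (U, \<phi>) (\<phi> (\<gamma> t)) (velocity A a b \<gamma> t (U, \<phi>)) (X t (U, \<phi>))
     else 0)"


section \<open>The variational problem\<close>

definition admissible ::
    "('q::topological_space, 'e::euclidean_space) chart set \<Rightarrow> real \<Rightarrow> real \<Rightarrow>
     'q \<times> ('q, 'e) tangent \<Rightarrow> 'q \<times> ('q, 'e) tangent \<Rightarrow> (real \<Rightarrow> 'q) set" where
  "admissible A a b \<xi> \<eta> = {\<gamma> \<in> extensional {a..b}.
     Ck_curve A 1 a b \<gamma> \<and> piecewise_smooth_curve A a b \<gamma> \<and>
     (\<gamma> a, velocity A a b \<gamma> a) = \<xi> \<and> (\<gamma> b, velocity A a b \<gamma> b) = \<eta>}"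

text \<open>
  The acceleration is defined except at the finitely many break points, which do not affect the
  integral.
\<close>

definition J_functional ::
    "('q, 'e::euclidean_space) chart set \<Rightarrow> ('q \<Rightarrow> ('q, 'e) tangent \<Rightarrow> ('q, 'e) tangent \<Rightarrow> real) \<Rightarrow>
     (('q, 'e) chart \<Rightarrow> 'e \<Rightarrow> 'e \<Rightarrow> 'e \<Rightarrow> 'e) \<Rightarrow> ('q \<Rightarrow> real) \<Rightarrow> real \<Rightarrow> real \<Rightarrow> (real \<Rightarrow> 'q) \<Rightarrow> real" where
  "J_functional A g \<Gamma> V a b \<gamma> = integral {a..b} (\<lambda>t.
     1 / 2 * (metric_norm g (\<gamma> t) (covariant_derivative A \<Gamma> a b \<gamma> (velocity A a b \<gamma>) t))\<^sup>2 + V (\<gamma> t))"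

text \<open>
  The topology of uniform \<open>C\<^sup>1\<close> convergence in charts (the compact-open, or weak, \<open>C\<^sup>1\<close> topology)
  on the set of \<open>C\<^sup>1\<close> curves on \<open>{a..b}\<close>.
\<close>

definition C1_subbasic ::
    "('q::topological_space, 'e::euclidean_space) chart set \<Rightarrow> real \<Rightarrow> real \<Rightarrow> (real \<Rightarrow> 'q) \<Rightarrow>
     ('q, 'e) chart \<Rightarrow> real set \<Rightarrow> real \<Rightarrow> (real \<Rightarrow> 'q) set" where
  "C1_subbasic A a b \<gamma> c K \<epsilon> = {\<gamma>' \<in> extensional {a..b}. Ck_curve A 1 a b \<gamma>' \<and>
     (\<forall>t\<in>K. \<gamma>' t \<in> fst c \<and> norm (snd c (\<gamma>' t) - snd c (\<gamma> t)) < \<epsilon> \<and>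
            norm (velocity A a b \<gamma>' t c - velocity A a b \<gamma> t c) < \<epsilon>)}"

definition C1_topology ::
    "('q::topological_space, 'e::euclidean_space) chart set \<Rightarrow> real \<Rightarrow> real \<Rightarrow> (real \<Rightarrow> 'q) topology" where
  "C1_topology A a b = topology_generated_by
     {C1_subbasic A a b \<gamma> c K \<epsilon> | \<gamma> c K \<epsilon>. Ck_curve A 1 a b \<gamma> \<and> c \<in> A \<and>
        compact K \<and> K \<subseteq> {a..b} \<and> \<gamma> ` K \<subseteq> fst c \<and> 0 < \<epsilon>}"

definition local_minimizer ::
    "('q::topological_space, 'e::euclidean_space) chart set \<Rightarrow>
     ('q \<Rightarrow> ('q, 'e) tangent \<Rightarrow> ('q, 'e) tangent \<Rightarrow> real) \<Rightarrow>
     (('q, 'e) chart \<Rightarrow> 'e \<Rightarrow> 'e \<Rightarrow> 'e \<Rightarrow> 'e) \<Rightarrow> ('q \<Rightarrow> real) \<Rightarrow> real \<Rightarrow> real \<Rightarrow>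
     'q \<times> ('q, 'e) tangent \<Rightarrow> 'q \<times> ('q, 'e) tangent \<Rightarrow> (real \<Rightarrow> 'q) \<Rightarrow> bool" where
  "local_minimizer A g \<Gamma> V a b \<xi> \<eta> \<gamma> \<longleftrightarrow>
     \<gamma> \<in> admissible A a b \<xi> \<eta> \<and>
     (\<exists>W. openin (subtopology (C1_topology A a b) (admissible A a b \<xi> \<eta>)) W \<and> \<gamma> \<in> W \<and>
          (\<forall>\<gamma>'\<in>W. J_functional A g \<Gamma> V a b \<gamma> \<le> J_functional A g \<Gamma> V a b \<gamma>'))"

end

theory Submission
  imports Defs
begin

text \<open>
  A competitor of the restricted curve can be inserted into \<open>q\<close> in place of \<open>q\<close> on \<open>{a..b}\<close>. It has
  the same position and velocity as \<open>q\<close> at \<open>a\<close> and at \<open>b\<close>, so the resulting curve is again \<open>C\<^sup>1\<close> and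
  piecewise smooth and has the end data of \<open>q\<close>: it is admissible on \<open>{0..T}\<close>
  (\<open>C1_curve_insert\<close>, \<open>piecewise_smooth_curve_insert\<close>). Insertion is continuous for the \<open>C\<^sup>1\<close>
  topologies (\<open>continuous_map_insert_curve\<close>), so competitors close to the restriction yield curves in
  the neighbourhood in which \<open>q\<close> is minimal. Both \<open>q\<close> and the new curve have the same Lagrangian
  outside \<open>{a..b}\<close>; since \<open>J\<close> is additive over subintervals (\<open>J_functional_split\<close>), the contributions
  from outside cancel in the inequality for \<open>{0..T}\<close> and leave the inequality for \<open>{a..b}\<close>.

  Additivity of the integral requires the Lagrangian to be integrable, which is where the geometry
  enters. On a smooth piece the Lagrangian is continuous (\<open>continuous_on_lagrangian\<close>): in a fixed
  chart it is a polynomial in coordinates of velocity and acceleration with coefficients that are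
  continuous in the point. Writing the squared norm of the acceleration in one chart presupposes that
  the representations of the acceleration in the various charts belong to one tangent vector
  (\<open>acceleration_is_coord_vector\<close>). The second derivatives of the transition maps that arise on
  differentiating the velocity are cancelled by those in the transformation law of the Christoffel
  maps.
\<close>

section \<open>Differentiability on relatively open subsets of an interval\<close>

lemma Ck_on_cong:
  "(\<And>x. x \<in> S \<Longrightarrow> f x = g x) \<Longrightarrow> Ck_on k S f = Ck_on k S g"
proof (induction k arbitrary: f g)
  case 0
  then show ?case by (simp cong: continuous_on_cong)
next
  case (Suc k)
  have deriv: "(f has_derivative D) (at x within S) = (g has_derivative D) (at x within S)"
    if "x \<in> S" for x D
    using has_derivative_transform[OF that, of f g D] has_derivative_transform[OF that, of g f D]
      Suc.prems by metis
  have "frechet_derivative f (at x within S) = frechet_derivative g (at x within S)"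
    if "x \<in> S" for x
    unfolding frechet_derivative_def using deriv[OF that] by simp
  then have "Ck_on k S (\<lambda>x. frechet_derivative f (at x within S) v) =
      Ck_on k S (\<lambda>x. frechet_derivative g (at x within S) v)" for v
    by (intro Suc.IH) auto
  moreover have "f differentiable_on S \<longleftrightarrow> g differentiable_on S"
    unfolding differentiable_on_def differentiable_def using deriv by auto
  ultimately show ?case by simp
qed

text \<open>
  The pieces of a curve that lie in one chart are parametrized by relatively open subsets of the
  interval. This lemma lets derivatives within such a set be computed within the whole interval.
\<close>
lemma at_within_Int_open:
  fixes x :: "'a::topological_space"
  assumes "open W" "x \<in> W"
  shows "at x within (S \<inter> W) = at x within S"
  by (rule at_within_nhd[OF assms(2,1)]) auto

text \<open>
  Translates the Frechet derivatives in the definition of \<open>Ck_on\<close> into the vector derivatives in the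
  definition of velocity; nondegeneracy of the interval makes both unique.
\<close>
lemma frechet_derivative_interval:
  fixes f :: "real \<Rightarrow> 'b::euclidean_space"
  assumes "a < b" "t \<in> {a..b}" "f differentiable (at t within {a..b})"
  shows "frechet_derivative f (at t within {a..b}) v =
    v *\<^sub>R vector_derivative f (at t within {a..b})"
proof -
  let ?D = "frechet_derivative f (at t within {a..b})"
  have D: "(f has_derivative ?D) (at t within {a..b})"
    using assms(3) by (simp add: frechet_derivative_works)
  then have lin: "?D r = r *\<^sub>R ?D 1" for r
    using linear_scale[OF has_derivative_linear[OF D], of r 1] by simp
  have "(f has_vector_derivative ?D 1) (at t within {a..b})"
    using D lin unfolding has_vector_derivative_def by (metis (no_types, lifting) ext)
  then have "vector_derivative f (at t within {a..b}) = ?D 1"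
    using assms by (intro vector_derivative_within_closed_interval) auto
  then show ?thesis using lin[of v] by simp
qed

lemma Ck_on_Suc_intervalD:
  fixes f :: "real \<Rightarrow> 'b::euclidean_space"
  assumes "a < b" "open W" and S: "S = {a..b} \<inter> W" and f: "Ck_on (Suc k) S f"
  shows "t \<in> S \<Longrightarrow> (f has_vector_derivative vector_derivative f (at t within {a..b}))
      (at t within {a..b})"
    and "Ck_on k S (\<lambda>t. vector_derivative f (at t within {a..b}))"
proof -
  have at: "at t within S = at t within {a..b}" if "t \<in> S" for t
    using that assms by (simp add: at_within_Int_open)
  have diff: "f differentiable (at t within {a..b})" if "t \<in> S" for t
    using f that at[OF that] by (auto simp: differentiable_on_def)
  then show "t \<in> S \<Longrightarrow> (f has_vector_derivative vector_derivative f (at t within {a..b}))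
      (at t within {a..b})"
    by (simp add: vector_derivative_works)
  have "Ck_on k S (\<lambda>x. frechet_derivative f (at x within S) 1)"
    using f by simp
  then show "Ck_on k S (\<lambda>t. vector_derivative f (at t within {a..b}))"
    by (rule Ck_on_cong[THEN iffD1, rotated])
      (use at diff S frechet_derivative_interval[OF assms(1), of _ f 1] in auto)
qed

lemma C1_on_intervalI:
  fixes f :: "real \<Rightarrow> 'b::euclidean_space"
  assumes "a < b" "open W" and S: "S = {a..b} \<inter> W"
    and f: "\<And>t. t \<in> S \<Longrightarrow> (f has_vector_derivative f' t) (at t within {a..b})"
    and f': "continuous_on S f'"
  shows "Ck_on 1 S f"
proof -
  have at: "at t within S = at t within {a..b}" if "t \<in> S" for t
    using that assms by (simp add: at_within_Int_open)
  have diff: "f differentiable (at t within {a..b})" if "t \<in> S" for t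
    using f[OF that] by (rule differentiableI_vector)
  have "frechet_derivative f (at t within S) v = v *\<^sub>R f' t" if "t \<in> S" for t v
    using that at[OF that] frechet_derivative_interval[OF assms(1) _ diff[OF that], of v]
      vector_derivative_within_closed_interval[OF assms(1) _ f[OF that]] S by auto
  then have "continuous_on S (\<lambda>t. frechet_derivative f (at t within S) v)" for v
    using f' by (simp add: continuous_on_scaleR cong: continuous_on_cong)
  then show ?thesis
    using at diff by (simp add: differentiable_on_def)
qed


section \<open>Charts and transition maps\<close>

lemma smooth_atlasD:
  assumes "smooth_atlas A" "c \<in> A"
  shows "is_chart c" "open (fst c)"
  using assms by (cases c; auto simp: smooth_atlas_def is_chart_def)+

lemma inv_into_chart:
  assumes "is_chart c" "p \<in> fst c"
  shows "inv_into (fst c) (snd c) (snd c p) = p"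
  using assms by (auto simp: is_chart_def homeomorphism_def split: prod.splits)

lemma transition_apply:
  assumes "is_chart c" "p \<in> fst c"
  shows "transition c c' (snd c p) = snd c' p"
  using inv_into_chart[OF assms] by (cases c; cases c'; simp add: transition_def)

lemma open_chart_image:
  assumes "is_chart c" "open U"
  shows "open (snd c ` (fst c \<inter> U))"
proof -
  have h: "homeomorphism (fst c) (snd c ` fst c) (snd c) (inv_into (fst c) (snd c))"
    and "open (snd c ` fst c)"
    using assms by (auto simp: is_chart_def split: prod.splits)
  moreover have "openin (top_of_set (snd c ` fst c)) (snd c ` (fst c \<inter> U))"
    using assms by (intro homeomorphism_imp_open_map[OF h]) auto
  ultimately show ?thesis by (blast intro: openin_open_trans)
qed

text \<open>
  The two orders of differentiability of a transition map that occur when a velocity and an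
  acceleration change coordinates.
\<close>
lemma transition_derivatives:
  assumes A: "smooth_atlas A" "c \<in> A" "c' \<in> A" and x: "x \<in> snd c ` (fst c \<inter> fst c')"
  defines "D \<equiv> \<lambda>y. frechet_derivative (transition c c') (at y)"
  shows "(transition c c' has_derivative D x) (at x)"
    and "((\<lambda>y. D y v) has_derivative frechet_derivative (\<lambda>y. D y v) (at x)) (at x)"
proof -
  let ?O = "snd c ` (fst c \<inter> fst c')"
  have O: "open ?O"
    using A by (simp add: open_chart_image smooth_atlasD)
  have "Ck_on (Suc (Suc 0)) ?O (transition c c')"
    using A unfolding smooth_atlas_def smooth_on_def by blast
  then have 1: "transition c c' differentiable_on ?O"
    and 2: "(\<lambda>y. frechet_derivative (transition c c') (at y within ?O) v) differentiable_on ?O"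
    by simp_all
  show "(transition c c' has_derivative D x) (at x)"
    using bspec[OF 1[unfolded differentiable_on_def] x]
    unfolding D_def at_within_open[OF x O] frechet_derivative_works .
  have "(\<lambda>y. frechet_derivative (transition c c') (at y within ?O) v) differentiable (at x)"
    using bspec[OF 2[unfolded differentiable_on_def] x] unfolding at_within_open[OF x O] .
  then obtain E where
    "((\<lambda>y. frechet_derivative (transition c c') (at y within ?O) v) has_derivative E) (at x)"
    unfolding differentiable_def by blast
  then have "((\<lambda>y. D y v) has_derivative E) (at x)"
    by (rule has_derivative_transform_within_open[OF _ O x])
      (simp only: D_def at_within_open[OF _ O])
  then show "((\<lambda>y. D y v) has_derivative frechet_derivative (\<lambda>y. D y v) (at x)) (at x)"
    unfolding frechet_derivative_works[symmetric] by (rule differentiableI)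
qed

text \<open>
  The compatibility of the representations in two charts \<open>c1\<close> and \<open>c2\<close> is the chain rule for the
  cocycle identity of the transition maps, which holds near the coordinates of \<open>p\<close> in \<open>c\<close>.
\<close>
lemma coord_vector_in_tangent_space:
  assumes A: "smooth_atlas A" "c \<in> A" and p: "p \<in> fst c"
  shows "coord_vector A c p u \<in> tangent_space A p"
proof -
  have "coord_vector A c p u c2 =
      frechet_derivative (transition c1 c2) (at (snd c1 p)) (coord_vector A c p u c1)"
    if c: "c1 \<in> A" "c2 \<in> A" "p \<in> fst c1" "p \<in> fst c2" for c1 c2
  proof -
    let ?O = "snd c ` (fst c \<inter> (fst c1 \<inter> fst c2))"
    have O: "open ?O" "snd c p \<in> ?O"
      using A c p by (auto simp: smooth_atlasD intro!: open_chart_image)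
    have eq: "(transition c1 c2 \<circ> transition c c1) y = transition c c2 y" if "y \<in> ?O" for y
      using that A c by (auto simp: transition_apply smooth_atlasD)
    have "(transition c c1 has_derivative frechet_derivative (transition c c1) (at (snd c p)))
        (at (snd c p))"
      using A c p by (intro transition_derivatives(1)) auto
    moreover have "(transition c1 c2 has_derivative
        frechet_derivative (transition c1 c2) (at (snd c1 p)))
        (at (transition c c1 (snd c p)))"
      using transition_derivatives(1)[OF A(1) c(1,2), of "snd c1 p"] A c p
      by (simp add: transition_apply smooth_atlasD)
    ultimately have "(transition c1 c2 \<circ> transition c c1 has_derivative
        frechet_derivative (transition c1 c2) (at (snd c1 p)) \<circ>
        frechet_derivative (transition c c1) (at (snd c p))) (at (snd c p))"
      by (rule diff_chain_at)
    then have "(transition c c2 has_derivative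
        frechet_derivative (transition c1 c2) (at (snd c1 p)) \<circ>
        frechet_derivative (transition c c1) (at (snd c p))) (at (snd c p))"
      by (rule has_derivative_transform_within_open[OF _ O eq])
    then have "frechet_derivative (transition c c2) (at (snd c p)) =
        frechet_derivative (transition c1 c2) (at (snd c1 p)) \<circ>
        frechet_derivative (transition c c1) (at (snd c p))"
      by (metis frechet_derivative_at)
    then show ?thesis
      using c by (simp add: coord_vector_def)
  qed
  moreover have "coord_vector A c p u c1 = 0" if "c1 \<notin> A \<or> p \<notin> fst c1" for c1
    using that by (auto simp: coord_vector_def)
  ultimately show ?thesis
    unfolding tangent_space_def by blast
qed

text \<open>
  A metric is bilinear only on tangent spaces. Hence coordinate vectors have to be tangent vectors
  first; the second argument is then handled by symmetry.
\<close>
lemma bilinear_local_metric: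
  assumes A: "smooth_atlas A" "c \<in> A" and g: "riemannian_metric A g"
    and x: "x \<in> snd c ` fst c"
  shows "bilinear (local_metric A g c x)"
proof -
  obtain p where p: "p \<in> fst c" "x = snd c p" using x by auto
  have inv: "inv_into (fst c) (snd c) x = p"
    using p A by (simp add: inv_into_chart smooth_atlasD)
  have T: "coord_vector A c p u \<in> tangent_space A p" for u
    by (rule coord_vector_in_tangent_space[OF A p(1)])
  have comb: "coord_vector A c p (r *\<^sub>R u + s *\<^sub>R v) =
      (\<lambda>c'. r *\<^sub>R coord_vector A c p u c' + s *\<^sub>R coord_vector A c p v c')" for r s u v
  proof
    fix c'
    have "linear (frechet_derivative (transition c c') (at (snd c p)))"
      if "c' \<in> A" "p \<in> fst c'"
      using that A p by (intro has_derivative_linear[OF transition_derivatives(1)]) auto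
    then show "coord_vector A c p (r *\<^sub>R u + s *\<^sub>R v) c' =
        r *\<^sub>R coord_vector A c p u c' + s *\<^sub>R coord_vector A c p v c'"
      by (simp add: coord_vector_def linear_add linear_scale)
  qed
  have l: "local_metric A g c x (r *\<^sub>R u + s *\<^sub>R v) w =
      r * local_metric A g c x u w + s * local_metric A g c x v w" for r s u v w
    using g T unfolding local_metric_def riemannian_metric_def Let_def inv comb by blast
  have sym: "local_metric A g c x u w = local_metric A g c x w u" for u w
    using g T unfolding local_metric_def riemannian_metric_def Let_def inv by blast
  have "linear (\<lambda>u. local_metric A g c x u w)" for w
    using l[of 1 _ 1] l[of _ _ 0] by (intro linearI) auto
  then show ?thesis
    unfolding bilinear_def using sym by simp
qed


section \<open>Velocity and acceleration in charts\<close>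

lemma velocity_apply:
  "velocity A a b \<gamma> t c =
    (if c \<in> A \<and> \<gamma> t \<in> fst c then vector_derivative (snd c \<circ> \<gamma>) (at t within {a..b}) else 0)"
  by (cases c) (simp add: velocity_def)

lemma covariant_derivative_apply:
  "covariant_derivative A \<Gamma> a b \<gamma> X t c =
    (if c \<in> A \<and> \<gamma> t \<in> fst c
     then vector_derivative (\<lambda>s. X s c) (at t within {a..b}) +
       \<Gamma> c (snd c (\<gamma> t)) (velocity A a b \<gamma> t c) (X t c)
     else 0)"
  by (cases c) (simp add: covariant_derivative_def)

lemma Ck_curve_iff:
  "Ck_curve A k a b \<gamma> \<longleftrightarrow>
    continuous_on {a..b} \<gamma> \<and> (\<forall>c\<in>A. Ck_on k ({a..b} \<inter> \<gamma> -` fst c) (snd c \<circ> \<gamma>))"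
  by (simp add: Ck_curve_def split_beta)

lemma Ck_curve_continuous_on: "Ck_curve A k a b \<gamma> \<Longrightarrow> continuous_on {a..b} \<gamma>"
  by (simp add: Ck_curve_def)

lemma relatively_open_preimage:
  assumes "continuous_on S \<gamma>" "open U"
  obtains W where "open W" "S \<inter> \<gamma> -` U = S \<inter> W"
proof -
  obtain W where "open W" "W \<inter> S = \<gamma> -` U \<inter> S"
    using assms unfolding continuous_on_open_invariant by blast
  then show ?thesis by (intro that[of W]) auto
qed

lemma Ck_curve_SucD:
  assumes "smooth_atlas A" "a < b" "Ck_curve A (Suc k) a b \<gamma>" "c \<in> A"
  shows "t \<in> {a..b} \<Longrightarrow> \<gamma> t \<in> fst c \<Longrightarrow>
      (snd c \<circ> \<gamma> has_vector_derivative velocity A a b \<gamma> t c) (at t within {a..b})"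
    and "Ck_on k ({a..b} \<inter> \<gamma> -` fst c) (\<lambda>t. velocity A a b \<gamma> t c)"
proof -
  obtain W where W: "open W" "{a..b} \<inter> \<gamma> -` fst c = {a..b} \<inter> W"
    using relatively_open_preimage[of "{a..b}" \<gamma> "fst c"] assms
    by (auto simp: Ck_curve_iff smooth_atlasD)
  have f: "Ck_on (Suc k) ({a..b} \<inter> \<gamma> -` fst c) (snd c \<circ> \<gamma>)"
    using assms by (simp add: Ck_curve_iff del: Ck_on.simps)
  note D = Ck_on_Suc_intervalD[OF assms(2) W f]
  show "t \<in> {a..b} \<Longrightarrow> \<gamma> t \<in> fst c \<Longrightarrow>
      (snd c \<circ> \<gamma> has_vector_derivative velocity A a b \<gamma> t c) (at t within {a..b})"
    using D(1)[of t] assms(4) by (simp add: velocity_apply)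
  show "Ck_on k ({a..b} \<inter> \<gamma> -` fst c) (\<lambda>t. velocity A a b \<gamma> t c)"
    using D(2) by (rule Ck_on_cong[THEN iffD1, rotated]) (use assms(4) in \<open>auto simp: velocity_apply\<close>)
qed

text \<open>
  Exhibiting a continuous candidate for the velocity suffices for a curve to be \<open>C\<^sup>1\<close>; this is how
  restricted and inserted curves are treated.
\<close>
lemma C1_curveI:
  assumes "smooth_atlas A" "a < b" and cont: "continuous_on {a..b} \<gamma>"
    and "\<And>c t. c \<in> A \<Longrightarrow> t \<in> {a..b} \<Longrightarrow> \<gamma> t \<in> fst c \<Longrightarrow>
      (snd c \<circ> \<gamma> has_vector_derivative v t c) (at t within {a..b})"
    and "\<And>c. c \<in> A \<Longrightarrow> continuous_on ({a..b} \<inter> \<gamma> -` fst c) (\<lambda>t. v t c)"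
  shows "Ck_curve A 1 a b \<gamma>"
  unfolding Ck_curve_iff
proof (intro conjI ballI cont)
  fix c assume c: "c \<in> A"
  obtain W where W: "open W" "{a..b} \<inter> \<gamma> -` fst c = {a..b} \<inter> W"
    using relatively_open_preimage[OF cont, of "fst c"] assms c by (auto simp: smooth_atlasD)
  show "Ck_on 1 ({a..b} \<inter> \<gamma> -` fst c) (snd c \<circ> \<gamma>)"
    by (rule C1_on_intervalI[OF assms(2) W, of _ "\<lambda>t. v t c"]) (use assms c in auto)
qed

lemma velocity_eqI:
  assumes "a < b" "t \<in> {a..b}"
    and "\<And>c. c \<in> A \<Longrightarrow> \<gamma> t \<in> fst c \<Longrightarrow>
      (snd c \<circ> \<gamma> has_vector_derivative w c) (at t within {a..b})"
    and "\<And>c. c \<notin> A \<or> \<gamma> t \<notin> fst c \<Longrightarrow> w c = 0"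
  shows "velocity A a b \<gamma> t = w"
proof
  fix c show "velocity A a b \<gamma> t c = w c"
    using assms(4)[of c] vector_derivative_within_closed_interval[OF assms(1,2,3)]
    by (auto simp: velocity_apply)
qed

text \<open>
  The product rule for a family of linear maps whose derivatives are given only pointwise, for each
  fixed argument. Expanding the argument in a basis reduces it to the product rule for scalars times
  vectors; \<open>L'\<close> is linear in its first argument by uniqueness of derivatives.
\<close>
lemma has_vector_derivative_linear_family:
  fixes L :: "'e::euclidean_space \<Rightarrow> 'e \<Rightarrow> 'b::real_normed_vector"
  assumes "open W" and W: "\<And>s. s \<in> S \<Longrightarrow> x s \<in> W" and t: "t \<in> S"
    and lin: "\<And>y. y \<in> W \<Longrightarrow> linear (L y)"
    and L': "\<And>w. ((\<lambda>y. L y w) has_derivative L' w) (at (x t))"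
    and x: "(x has_vector_derivative x') (at t within S)"
    and v: "(v has_vector_derivative v') (at t within S)"
  shows "((\<lambda>s. L (x s) (v s)) has_vector_derivative L' (v t) x' + L (x t) v') (at t within S)"
proof -
  have expand: "L y w = (\<Sum>i\<in>Basis. (w \<bullet> i) *\<^sub>R L y i)" if "y \<in> W" for y w
  proof -
    have "L y w = L y (\<Sum>i\<in>Basis. (w \<bullet> i) *\<^sub>R i)" by (simp add: euclidean_representation)
    also have "\<dots> = (\<Sum>i\<in>Basis. (w \<bullet> i) *\<^sub>R L y i)"
      using lin[OF that] by (simp add: linear_sum linear_scale)
    finally show ?thesis .
  qed
  have "L' w = (\<lambda>h. \<Sum>i\<in>Basis. (w \<bullet> i) *\<^sub>R L' i h)" for w
  proof (rule has_derivative_unique[OF L'])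
    have "((\<lambda>y. \<Sum>i\<in>Basis. (w \<bullet> i) *\<^sub>R L y i) has_derivative
        (\<lambda>h. \<Sum>i\<in>Basis. (w \<bullet> i) *\<^sub>R L' i h)) (at (x t))"
      by (intro has_derivative_sum has_derivative_scaleR_right L')
    then show "((\<lambda>y. L y w) has_derivative (\<lambda>h. \<Sum>i\<in>Basis. (w \<bullet> i) *\<^sub>R L' i h)) (at (x t))"
      by (rule has_derivative_transform_within_open[OF _ assms(1) W[OF t]]) (simp add: expand)
  qed
  then have L'x': "L' (v t) x' = (\<Sum>i\<in>Basis. (v t \<bullet> i) *\<^sub>R L' i x')" by metis
  have "((\<lambda>s. \<Sum>i\<in>Basis. (v s \<bullet> i) *\<^sub>R L (x s) i) has_vector_derivative
      (\<Sum>i\<in>Basis. (v t \<bullet> i) *\<^sub>R L' i x' + (v' \<bullet> i) *\<^sub>R L (x t) i)) (at t within S)"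
  proof (intro has_vector_derivative_sum has_vector_derivative_scaleR)
    fix i :: 'e
    show "((\<lambda>s. v s \<bullet> i) has_real_derivative v' \<bullet> i) (at t within S)"
      unfolding has_real_derivative_iff_has_vector_derivative
      by (rule bounded_linear.has_vector_derivative[OF bounded_linear_inner_left v])
    have "((\<lambda>y. L y i) has_derivative L' i) (at (x t) within x ` S)"
      using L' by (rule has_derivative_at_withinI)
    then show "((\<lambda>s. L (x s) i) has_vector_derivative L' i x') (at t within S)"
      using vector_derivative_diff_chain_within[OF x] by (simp add: o_def)
  qed
  then have "((\<lambda>s. L (x s) (v s)) has_vector_derivative
      (\<Sum>i\<in>Basis. (v t \<bullet> i) *\<^sub>R L' i x' + (v' \<bullet> i) *\<^sub>R L (x t) i)) (at t within S)"
    by (rule has_vector_derivative_transform[OF t, rotated]) (use W expand in simp)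
  then show ?thesis
    by (simp add: sum.distrib L'x' expand[OF W[OF t], of v'])
qed

lemma velocity_change_chart:
  assumes A: "smooth_atlas A" "c \<in> A" "c' \<in> A" and "a < b" and \<gamma>: "Ck_curve A (Suc k) a b \<gamma>"
    and t: "t \<in> {a..b}" "\<gamma> t \<in> fst c" "\<gamma> t \<in> fst c'"
  shows "velocity A a b \<gamma> t c' =
    frechet_derivative (transition c c') (at (snd c (\<gamma> t))) (velocity A a b \<gamma> t c)"
proof -
  obtain W where W: "open W" "{a..b} \<inter> \<gamma> -` (fst c \<inter> fst c') = {a..b} \<inter> W"
    by (rule relatively_open_preimage[OF Ck_curve_continuous_on[OF \<gamma>]
          open_Int[OF smooth_atlasD(2)[OF A(1,2)] smooth_atlasD(2)[OF A(1,3)]]])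
  then have tW: "t \<in> {a..b} \<inter> W" using t by blast
  have domains: "\<gamma> s \<in> fst c" "\<gamma> s \<in> fst c'" if "s \<in> {a..b} \<inter> W" for s
    using that W(2) by blast+
  have at: "at t within ({a..b} \<inter> W) = at t within {a..b}"
    using W tW by (simp add: at_within_Int_open)
  let ?D = "frechet_derivative (transition c c') (at (snd c (\<gamma> t)))"
  have D: "(transition c c' has_derivative ?D) (at ((snd c \<circ> \<gamma>) t) within (snd c \<circ> \<gamma>) ` {a..b})"
    using transition_derivatives(1)[OF A] t by (auto intro: has_derivative_at_withinI)
  have "(transition c c' \<circ> (snd c \<circ> \<gamma>) has_vector_derivative ?D (velocity A a b \<gamma> t c))
      (at t within {a..b})"
    by (intro vector_derivative_diff_chain_within[OF _ D] Ck_curve_SucD(1)[OF A(1) assms(4) \<gamma> A(2)] t)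
  then have "(snd c' \<circ> \<gamma> has_vector_derivative ?D (velocity A a b \<gamma> t c))
      (at t within ({a..b} \<inter> W))"
    unfolding at[symmetric]
    by (rule has_vector_derivative_transform[OF tW, rotated])
      (use A domains in \<open>simp add: transition_apply smooth_atlasD\<close>)
  then show ?thesis
    using vector_derivative_within_closed_interval[OF assms(4) t(1)] t A
    unfolding at by (simp add: velocity_apply)
qed

text \<open>
  Let \<open>x\<close> and \<open>v\<close> be the coordinates of the curve and its velocity in \<open>c\<close>, and \<open>D\<close> the derivative of
  the change of coordinates to \<open>c'\<close>. The velocity in \<open>c'\<close> is \<open>D x v\<close>, whose derivative is \<open>D x v'\<close> plus
  the second derivative of the change of coordinates applied to \<open>v\<close> and \<open>v\<close>. Solved for the
  Christoffel map of \<open>c'\<close> at \<open>D x v\<close> and \<open>D x v\<close>, the transformation law contains this second-order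
  term with a negative sign. So the covariant derivative transforms by \<open>D x\<close> alone.
\<close>
lemma acceleration_is_coord_vector:
  assumes A: "smooth_atlas A" and \<Gamma>: "affine_connection A \<Gamma>" and c: "c \<in> A"
    and "a < b" and \<gamma>: "Ck_curve A 2 a b \<gamma>"
    and t: "t \<in> {a..b}" "\<gamma> t \<in> fst c"
  defines "X \<equiv> covariant_derivative A \<Gamma> a b \<gamma> (velocity A a b \<gamma>)"
  shows "X t = coord_vector A c (\<gamma> t) (X t c)"
proof
  fix c'
  have \<gamma>2: "Ck_curve A (Suc (Suc 0)) a b \<gamma>" using \<gamma> by (simp add: numeral_2_eq_2)
  show "X t c' = coord_vector A c (\<gamma> t) (X t c) c'"
  proof (cases "c' \<in> A \<and> \<gamma> t \<in> fst c'")
    case False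
    then show ?thesis by (auto simp: X_def covariant_derivative_apply coord_vector_def)
  next
    case True
    then have c': "c' \<in> A" "\<gamma> t \<in> fst c'" by auto
    define D where "D = (\<lambda>y. frechet_derivative (transition c c') (at y))"
    define x where "x = snd c (\<gamma> t)"
    define v where "v = velocity A a b \<gamma> t c"
    have xO: "x \<in> snd c ` (fst c \<inter> fst c')" using t c' by (auto simp: x_def)
    have Dlin: "linear (D y)" if "y \<in> snd c ` (fst c \<inter> fst c')" for y
      unfolding D_def by (rule has_derivative_linear[OF transition_derivatives(1)[OF A c c'(1) that]])
    obtain W where W: "open W" "{a..b} \<inter> \<gamma> -` (fst c \<inter> fst c') = {a..b} \<inter> W"
      by (rule relatively_open_preimage[OF Ck_curve_continuous_on[OF \<gamma>]
            open_Int[OF smooth_atlasD(2)[OF A c] smooth_atlasD(2)[OF A c'(1)]]])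
    let ?S = "{a..b} \<inter> W"
    have tS: "t \<in> ?S" using W(2) t c' by blast
    have at: "at t within ?S = at t within {a..b}"
      using W tS by (simp add: at_within_Int_open)
    have acc: "((\<lambda>s. velocity A a b \<gamma> s d) has_vector_derivative
        vector_derivative (\<lambda>s. velocity A a b \<gamma> s d) (at t within {a..b})) (at t within {a..b})"
      if d: "d \<in> A" "\<gamma> t \<in> fst d" for d
    proof -
      obtain W' where W': "open W'" "{a..b} \<inter> \<gamma> -` fst d = {a..b} \<inter> W'"
        using relatively_open_preimage[of "{a..b}" \<gamma> "fst d"] A d \<gamma>
        by (auto simp: Ck_curve_iff smooth_atlasD)
      show ?thesis
        by (rule Ck_on_Suc_intervalD(1)[OF assms(4) W' Ck_curve_SucD(2)[OF A assms(4) \<gamma>2 d(1)]])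
          (use t d in auto)
    qed
    define v' where "v' = vector_derivative (\<lambda>s. velocity A a b \<gamma> s c) (at t within {a..b})"
    have change: "velocity A a b \<gamma> s c' = D ((snd c \<circ> \<gamma>) s) (velocity A a b \<gamma> s c)"
      if "s \<in> ?S" for s
    proof -
      have "s \<in> {a..b}" "\<gamma> s \<in> fst c" "\<gamma> s \<in> fst c'" using that W(2) by blast+
      then show ?thesis
        using velocity_change_chart[OF A c c'(1) assms(4) \<gamma>2] by (simp add: D_def)
    qed
    have "((\<lambda>s. D ((snd c \<circ> \<gamma>) s) (velocity A a b \<gamma> s c)) has_vector_derivative
        frechet_derivative (\<lambda>y. D y (velocity A a b \<gamma> t c)) (at x) v + D ((snd c \<circ> \<gamma>) t) v')
        (at t within ?S)"
    proof (rule has_vector_derivative_linear_family[where W = "snd c ` (fst c \<inter> fst c')" and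
          L' = "\<lambda>w. frechet_derivative (\<lambda>y. D y w) (at x)" and L = D])
      show "open (snd c ` (fst c \<inter> fst c'))"
        using A c c' by (simp add: open_chart_image smooth_atlasD)
      show "(snd c \<circ> \<gamma>) s \<in> snd c ` (fst c \<inter> fst c')" if "s \<in> ?S" for s
        using that W(2) by auto
      show "((\<lambda>y. D y w) has_derivative frechet_derivative (\<lambda>y. D y w) (at x)) (at ((snd c \<circ> \<gamma>) t))"
        for w
        using transition_derivatives(2)[OF A c c'(1) xO] by (simp add: x_def D_def)
      show "((snd c \<circ> \<gamma>) has_vector_derivative v) (at t within ?S)"
        unfolding at v_def using Ck_curve_SucD(1)[OF A assms(4) \<gamma>2 c t] .
      show "((\<lambda>s. velocity A a b \<gamma> s c) has_vector_derivative v') (at t within ?S)"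
        unfolding at v'_def by (rule acc[OF c t(2)])
    qed (use tS Dlin in auto)
    then have "((\<lambda>s. velocity A a b \<gamma> s c') has_vector_derivative
        frechet_derivative (\<lambda>y. D y (velocity A a b \<gamma> t c)) (at x) v + D ((snd c \<circ> \<gamma>) t) v')
        (at t within ?S)"
      by (rule has_vector_derivative_transform[OF tS, rotated]) (rule change)
    then have "((\<lambda>s. velocity A a b \<gamma> s c') has_vector_derivative
        frechet_derivative (\<lambda>y. D y v) (at x) v + D x v') (at t within ?S)"
      by (simp add: x_def v_def)
    then have v'_c': "vector_derivative (\<lambda>s. velocity A a b \<gamma> s c') (at t within {a..b}) =
        frechet_derivative (\<lambda>y. D y v) (at x) v + D x v'"
      unfolding at by (rule vector_derivative_within_closed_interval[OF assms(4) t(1)])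
    have v_c': "velocity A a b \<gamma> t c' = D x v"
      using velocity_change_chart[OF A c c'(1) assms(4) \<gamma>2 t c'(2)] by (simp add: D_def x_def v_def)
    have x_c': "transition c c' x = snd c' (\<gamma> t)"
      using A c t by (simp add: x_def transition_apply smooth_atlasD)
    \<comment> \<open>The second-order term here is the one in the derivative of the velocity.\<close>
    have "D x (\<Gamma> c x v v) =
        frechet_derivative (\<lambda>y. D y v) (at x) v + \<Gamma> c' (transition c c' x) (D x v) (D x v)"
      using \<Gamma> c c'(1) xO unfolding affine_connection_def Let_def D_def by blast
    moreover have "X t c = v' + \<Gamma> c x v v"
      using c t by (simp add: X_def covariant_derivative_apply v'_def v_def x_def)
    ultimately have "D x (X t c) = X t c'"
      using c' by (simp add: X_def covariant_derivative_apply v'_c' v_c' x_c'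
          linear_add[OF Dlin[OF xO]])
    then show ?thesis
      using c' by (simp add: coord_vector_def D_def x_def)
  qed
qed



section \<open>The Lagrangian along piecewise smooth curves\<close>

text \<open>
  Continuity of the coefficients suffices because a bilinear map on a finite-dimensional space is a
  finite sum of coordinate products. Applied to the Christoffel maps and to the metric.
\<close>
lemma continuous_on_bilinear_family:
  fixes h :: "'s::topological_space \<Rightarrow> 'e::euclidean_space \<Rightarrow> 'e \<Rightarrow> 'b::real_normed_vector"
  assumes bil: "\<And>t. t \<in> S \<Longrightarrow> bilinear (h t)"
    and h: "\<And>i j. continuous_on S (\<lambda>t. h t i j)"
    and "continuous_on S u" "continuous_on S w"
  shows "continuous_on S (\<lambda>t. h t (u t) (w t))"
proof -
  have "h t (u t) (w t) = (\<Sum>i\<in>Basis. \<Sum>j\<in>Basis. (u t \<bullet> i) *\<^sub>R (w t \<bullet> j) *\<^sub>R h t i j)"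
    if t: "t \<in> S" for t
  proof -
    have l: "linear (\<lambda>x. h t x y)" "linear (h t x)" for x y
      using bil[OF t] by (simp_all add: bilinear_def)
    have "h t i (w t) = (\<Sum>j\<in>Basis. (w t \<bullet> j) *\<^sub>R h t i j)" for i
    proof -
      have "h t i (w t) = h t i (\<Sum>j\<in>Basis. (w t \<bullet> j) *\<^sub>R j)"
        by (simp add: euclidean_representation)
      then show ?thesis
        by (simp add: linear_sum[OF l(2)] linear_scale[OF l(2)])
    qed
    then have w: "(\<Sum>i\<in>Basis. \<Sum>j\<in>Basis. (u t \<bullet> i) *\<^sub>R (w t \<bullet> j) *\<^sub>R h t i j) =
        (\<Sum>i\<in>Basis. (u t \<bullet> i) *\<^sub>R h t i (w t))"
      by (simp only: scaleR_sum_right)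
    have "h t (u t) (w t) = h t (\<Sum>i\<in>Basis. (u t \<bullet> i) *\<^sub>R i) (w t)"
      by (simp add: euclidean_representation)
    also have "\<dots> = (\<Sum>i\<in>Basis. (u t \<bullet> i) *\<^sub>R h t i (w t))"
      by (simp only: linear_sum[OF l(1)] linear_scale[OF l(1)])
    finally show ?thesis unfolding w .
  qed
  moreover have "continuous_on S
      (\<lambda>t. \<Sum>i\<in>Basis. \<Sum>j\<in>Basis. (u t \<bullet> i) *\<^sub>R (w t \<bullet> j) *\<^sub>R h t i j)"
    by (intro continuous_intros assms)
  ultimately show ?thesis
    by (simp cong: continuous_on_cong)
qed

lemma continuous_on_relatively_open_cover:
  fixes f :: "'a::t2_space \<Rightarrow> 'b::topological_space"
  assumes "\<And>x. x \<in> S \<Longrightarrow> \<exists>W. open W \<and> x \<in> W \<and> continuous_on (S \<inter> W) f"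
  shows "continuous_on S f"
  unfolding continuous_on_eq_continuous_within
proof
  fix x assume x: "x \<in> S"
  then obtain W where W: "open W" "x \<in> W" "continuous_on (S \<inter> W) f"
    using assms by blast
  then have "continuous (at x within (S \<inter> W)) f"
    using x by (simp add: continuous_on_eq_continuous_within)
  then show "continuous (at x within S) f"
    using at_within_Int_open[OF W(1,2), of S] by simp
qed

text \<open>
  The integrand of \<open>J\<close>. The interval is a parameter because velocities at its end points are
  one-sided.
\<close>
definition lagrangian ::
    "('q, 'e::euclidean_space) chart set \<Rightarrow> ('q \<Rightarrow> ('q, 'e) tangent \<Rightarrow> ('q, 'e) tangent \<Rightarrow> real) \<Rightarrow>
     (('q, 'e) chart \<Rightarrow> 'e \<Rightarrow> 'e \<Rightarrow> 'e \<Rightarrow> 'e) \<Rightarrow> ('q \<Rightarrow> real) \<Rightarrow> real \<Rightarrow> real \<Rightarrow> (real \<Rightarrow> 'q) \<Rightarrow>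
     real \<Rightarrow> real" where
  "lagrangian A g \<Gamma> V a b \<gamma> t =
     1 / 2 * (metric_norm g (\<gamma> t) (covariant_derivative A \<Gamma> a b \<gamma> (velocity A a b \<gamma>) t))\<^sup>2 + V (\<gamma> t)"

lemma J_functional_eq: "J_functional A g \<Gamma> V a b \<gamma> = integral {a..b} (lagrangian A g \<Gamma> V a b \<gamma>)"
  by (simp add: J_functional_def lagrangian_def[abs_def])

lemma smooth_on_imp_continuous_on: "smooth_on S f \<Longrightarrow> continuous_on S f"
  unfolding smooth_on_def by (drule spec[of _ 0]) simp

text \<open>
  Around each parameter the curve stays in one chart. There the acceleration is the coordinate vector
  of a continuous function \<open>X\<close>, so its squared norm is a value of the local metric, and \<open>V\<close> is
  continuous because it is smooth in coordinates.
\<close>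
lemma continuous_on_lagrangian:
  assumes A: "smooth_atlas A" and g: "riemannian_metric A g" and \<Gamma>: "affine_connection A \<Gamma>"
    and V: "smooth_function A V" and ab: "a < b" and \<gamma>: "Ck_curve A 2 a b \<gamma>"
  shows "continuous_on {a..b} (lagrangian A g \<Gamma> V a b \<gamma>)"
proof (rule continuous_on_relatively_open_cover)
  fix t0 assume t0: "t0 \<in> {a..b}"
  obtain c where c: "c \<in> A" "\<gamma> t0 \<in> fst c"
    using A unfolding smooth_atlas_def by blast
  define S where "S = {a..b} \<inter> \<gamma> -` fst c"
  obtain W where W: "open W" "S = {a..b} \<inter> W"
    unfolding S_def
    by (rule relatively_open_preimage[OF Ck_curve_continuous_on[OF \<gamma>] smooth_atlasD(2)[OF A c(1)]])
  have \<gamma>2: "Ck_curve A (Suc (Suc 0)) a b \<gamma>" using \<gamma> by (simp add: numeral_2_eq_2)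
  define x where "x = snd c \<circ> \<gamma>"
  define v where "v = (\<lambda>t. velocity A a b \<gamma> t c)"
  define v' where "v' = (\<lambda>t. vector_derivative v (at t within {a..b}))"
  define X where "X = (\<lambda>t. v' t + \<Gamma> c (x t) (v t) (v t))"
  have Ckv: "Ck_on (Suc 0) S v"
    unfolding v_def S_def by (rule Ck_curve_SucD(2)[OF A ab \<gamma>2 c(1)])
  have contv': "continuous_on S v'"
    using Ck_on_Suc_intervalD(2)[OF ab W Ckv] by (simp add: v'_def)
  have contv: "continuous_on S v"
    using Ckv by (simp add: differentiable_imp_continuous_on)
  have xS: "x t \<in> snd c ` fst c" if "t \<in> S" for t
    using that by (simp add: x_def S_def)
  have contx: "continuous_on S x"
  proof -
    have "Ck_on (Suc (Suc 0)) S x"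
      using \<gamma>2 c(1) unfolding Ck_curve_iff S_def x_def by blast
    then show ?thesis by (simp add: differentiable_imp_continuous_on)
  qed
  have along: "continuous_on S (\<lambda>t. f (x t))" if "continuous_on (snd c ` fst c) f"
    for f :: "'b \<Rightarrow> 'z::topological_space"
    by (rule continuous_on_compose2[OF that contx]) (use xS in auto)
  have \<Gamma>c: "\<forall>x\<in>snd c ` fst c. bilinear (\<Gamma> c x)" "\<forall>u w. smooth_on (snd c ` fst c) (\<lambda>x. \<Gamma> c x u w)"
    using \<Gamma> c(1) unfolding affine_connection_def by blast+
  have gc: "\<forall>u w. smooth_on (snd c ` fst c) (\<lambda>x. local_metric A g c x u w)"
    using g c(1) unfolding riemannian_metric_def by blast
  have contX: "continuous_on S X"
    unfolding X_def
  proof (rule continuous_on_add[OF contv'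
        continuous_on_bilinear_family[where h = "\<lambda>t. \<Gamma> c (x t)", OF _ _ contv contv]])
    show "bilinear (\<Gamma> c (x t))" if "t \<in> S" for t
      using \<Gamma>c(1) xS[OF that] by blast
    show "continuous_on S (\<lambda>t. \<Gamma> c (x t) i j)" for i j
      by (rule along[OF smooth_on_imp_continuous_on]) (use \<Gamma>c(2) in blast)
  qed
  have contg: "continuous_on S (\<lambda>t. local_metric A g c (x t) (X t) (X t))"
  proof (rule continuous_on_bilinear_family[where h = "\<lambda>t. local_metric A g c (x t)",
        OF _ _ contX contX])
    show "bilinear (local_metric A g c (x t))" if "t \<in> S" for t
      by (rule bilinear_local_metric[OF A c(1) g xS[OF that]])
    show "continuous_on S (\<lambda>t. local_metric A g c (x t) i j)" for i j
      by (rule along[OF smooth_on_imp_continuous_on]) (use gc in blast)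
  qed
  have "smooth_on (snd c ` fst c) (V \<circ> inv_into (fst c) (snd c))"
    using bspec[OF V[unfolded smooth_function_def] c(1)] by (simp only: split_beta)
  then have contV: "continuous_on S (\<lambda>t. (V \<circ> inv_into (fst c) (snd c)) (x t))"
    by (intro along smooth_on_imp_continuous_on)
  have eq: "lagrangian A g \<Gamma> V a b \<gamma> t =
      1 / 2 * (sqrt (local_metric A g c (x t) (X t) (X t)))\<^sup>2 +
        (V \<circ> inv_into (fst c) (snd c)) (x t)"
    if t: "t \<in> S" for t
  proof -
    have tS: "t \<in> {a..b}" "\<gamma> t \<in> fst c" using t by (auto simp: S_def)
    have inv: "inv_into (fst c) (snd c) (x t) = \<gamma> t"
      using inv_into_chart[OF smooth_atlasD(1)[OF A c(1)] tS(2)] by (simp add: x_def)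
    let ?D = "covariant_derivative A \<Gamma> a b \<gamma> (velocity A a b \<gamma>) t"
    have D: "?D c = X t"
      using c tS by (simp add: covariant_derivative_apply X_def v'_def v_def x_def)
    have "?D = coord_vector A c (\<gamma> t) (X t)"
      by (rule acceleration_is_coord_vector[OF A \<Gamma> c(1) ab \<gamma> tS, unfolded D])
    then show ?thesis
      by (simp add: lagrangian_def metric_norm_def local_metric_def inv Let_def)
  qed
  have "continuous_on S (\<lambda>t. 1 / 2 * (sqrt (local_metric A g c (x t) (X t) (X t)))\<^sup>2 +
        (V \<circ> inv_into (fst c) (snd c)) (x t))"
    by (intro continuous_on_add contV continuous_on_mult continuous_on_const continuous_on_power
        continuous_on_real_sqrt contg)
  then have "continuous_on S (lagrangian A g \<Gamma> V a b \<gamma>)"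
    by (rule continuous_on_eq) (simp only: eq)
  moreover have "t0 \<in> S" using t0 c(2) by (simp add: S_def)
  then have "t0 \<in> W" using W(2) by blast
  ultimately show "\<exists>W. open W \<and> t0 \<in> W \<and> continuous_on ({a..b} \<inter> W) (lagrangian A g \<Gamma> V a b \<gamma>)"
    using W(1) unfolding W(2) by blast
qed

lemma vector_derivative_local:
  assumes "open I" "t \<in> I" "I \<subseteq> S" "I \<subseteq> S'" "\<And>s. s \<in> I \<Longrightarrow> f s = f' s"
  shows "vector_derivative f (at t within S) = vector_derivative f' (at t within S')"
proof -
  have "(f has_vector_derivative d) (at t within I) \<longleftrightarrow> (f' has_vector_derivative d) (at t within I)"
    for d
    using has_vector_derivative_transform[OF assms(2), of f f' d]
      has_vector_derivative_transform[OF assms(2), of f' f d] assms(5) by metis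
  moreover have "at t within S = at t within I" "at t within S' = at t within I"
    using assms at_within_Int_open[OF assms(1,2), of S] at_within_Int_open[OF assms(1,2), of S']
    by (simp_all add: Int_absorb1)
  ultimately show ?thesis by (simp add: vector_derivative_def)
qed

text \<open>
  Derivatives at interior points do not see the interval or the rest of the curve. This compares the
  Lagrangians of a curve, of its restrictions and of its modifications elsewhere, away from end
  points.
\<close>
lemma lagrangian_local:
  fixes A :: "('q::topological_space, 'e::euclidean_space) chart set"
  assumes I: "open I" "t \<in> I" "I \<subseteq> {a..b}" "I \<subseteq> {c..d}" and eq: "\<And>s. s \<in> I \<Longrightarrow> \<gamma> s = \<gamma>' s"
  shows "lagrangian A g \<Gamma> V a b \<gamma> t = lagrangian A g \<Gamma> V c d \<gamma>' t"
proof -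
  have v: "velocity A a b \<gamma> s = velocity A c d \<gamma>' s" if "s \<in> I" for s
  proof
    fix k :: "('q, 'e) chart"
    have "vector_derivative (snd k \<circ> \<gamma>) (at s within {a..b}) =
        vector_derivative (snd k \<circ> \<gamma>') (at s within {c..d})"
      by (rule vector_derivative_local[OF I(1) that I(3,4)]) (simp add: eq)
    then show "velocity A a b \<gamma> s k = velocity A c d \<gamma>' s k"
      using eq[OF that] by (simp add: velocity_apply)
  qed
  have "vector_derivative (\<lambda>s. velocity A a b \<gamma> s k) (at t within {a..b}) =
      vector_derivative (\<lambda>s. velocity A c d \<gamma>' s k) (at t within {c..d})"
    for k :: "('q, 'e) chart"
    by (rule vector_derivative_local[OF I]) (simp add: v)
  then have "covariant_derivative A \<Gamma> a b \<gamma> (velocity A a b \<gamma>) t =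
      covariant_derivative A \<Gamma> c d \<gamma>' (velocity A c d \<gamma>') t"
    using eq[OF I(2)] v[OF I(2)] by (simp add: fun_eq_iff covariant_derivative_apply del: split_paired_All)
  then show ?thesis
    using eq[OF I(2)] by (simp add: lagrangian_def)
qed

lemma integrable_on_piecewise:
  fixes f :: "real \<Rightarrow> real"
  assumes "finite P" and "c \<le> d"
    and "\<And>c' d'. c \<le> c' \<Longrightarrow> c' < d' \<Longrightarrow> d' \<le> d \<Longrightarrow> {c'<..<d'} \<inter> P = {} \<Longrightarrow> f integrable_on {c'..d'}"
  shows "f integrable_on {c..d}"
  using assms
proof (induction P arbitrary: c d rule: finite_induct)
  case empty
  then show ?case using integrable_on_refl[of f c] by (cases "c = d") (auto simp: box_real)
next
  case (insert p P)
  show ?case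
  proof (cases "c < p \<and> p < d")
    case True
    have "f integrable_on {c..p}" "f integrable_on {p..d}"
      by (rule insert.IH; use True insert.prems(2) in auto)+
    then show ?thesis
      using True by (auto intro: Henstock_Kurzweil_Integration.integrable_combine[where c = p])
  next
    case False
    show ?thesis
      by (rule insert.IH) (use False insert.prems in auto)
  qed
qed

text \<open>
  On each smooth piece the integrand agrees, except at the two ends, with the integrand of the piece
  regarded as a curve of its own; the latter is continuous up to the ends.
\<close>
lemma lagrangian_integrable_on:
  assumes "smooth_atlas A" "riemannian_metric A g" "affine_connection A \<Gamma>" "smooth_function A V"
    and "a \<le> b" and \<gamma>: "piecewise_smooth_curve A a b \<gamma>"
  shows "lagrangian A g \<Gamma> V a b \<gamma> integrable_on {a..b}"
proof -
  obtain P where P: "finite P"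
    "\<And>c d k. a \<le> c \<Longrightarrow> c < d \<Longrightarrow> d \<le> b \<Longrightarrow> {c<..<d} \<inter> P = {} \<Longrightarrow> Ck_curve A k c d \<gamma>"
    using \<gamma> unfolding piecewise_smooth_curve_def by blast
  show ?thesis
  proof (rule integrable_on_piecewise[OF P(1) assms(5)])
    fix c d assume cd: "a \<le> c" "c < d" "d \<le> b" "{c<..<d} \<inter> P = {}"
    have "lagrangian A g \<Gamma> V c d \<gamma> integrable_on {c..d}"
      by (intro integrable_continuous_real continuous_on_lagrangian assms cd P(2))
    then show "lagrangian A g \<Gamma> V a b \<gamma> integrable_on {c..d}"
    proof (rule integrable_spike_finite[of "{c, d}", rotated 2])
      show "lagrangian A g \<Gamma> V a b \<gamma> t = lagrangian A g \<Gamma> V c d \<gamma> t"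
        if "t \<in> {c..d} - {c, d}" for t
        by (rule lagrangian_local[of "{c<..<d}"]) (use that cd in auto)
    qed simp
  qed
qed


section \<open>Inserting a curve into a longer curve\<close>

definition insert_curve :: "real \<Rightarrow> real \<Rightarrow> (real \<Rightarrow> 'q) \<Rightarrow> (real \<Rightarrow> 'q) \<Rightarrow> real \<Rightarrow> 'q" where
  "insert_curve a b \<gamma>' \<gamma> = (\<lambda>t. if t \<in> {a..b} then \<gamma>' t else \<gamma> t)"

lemma insert_curve_restrict: "insert_curve a b (restrict \<gamma> {a..b}) \<gamma> = \<gamma>"
  by (simp add: insert_curve_def fun_eq_iff)

lemma Ck_curve_cong:
  assumes "\<And>t. t \<in> {a..b} \<Longrightarrow> \<gamma> t = \<gamma>' t"
  shows "Ck_curve A k a b \<gamma> = Ck_curve A k a b \<gamma>'"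
proof -
  have "{a..b} \<inter> \<gamma> -` U = {a..b} \<inter> \<gamma>' -` U" for U
    using assms by auto
  moreover have "Ck_on k ({a..b} \<inter> \<gamma>' -` fst c) (snd c \<circ> \<gamma>) =
      Ck_on k ({a..b} \<inter> \<gamma>' -` fst c) (snd c \<circ> \<gamma>')" for c :: "'a set \<times> ('a \<Rightarrow> 'b)"
    by (rule Ck_on_cong) (simp add: assms)
  moreover have "continuous_on {a..b} \<gamma> = continuous_on {a..b} \<gamma>'"
    by (rule continuous_on_cong) (simp_all add: assms)
  ultimately show ?thesis
    by (simp only: Ck_curve_iff)
qed

text \<open>
  One-sided derivatives at an end point of the subinterval coincide with the derivatives of the long
  curve only because the latter exist; this is where the \<open>C\<^sup>1\<close> condition is needed.
\<close>
lemma velocity_subinterval: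
  assumes A: "smooth_atlas A" and cd: "c < d" "{c..d} \<subseteq> {a..b}" and \<gamma>: "Ck_curve A (Suc k) a b \<gamma>"
    and eq: "\<And>t. t \<in> {c..d} \<Longrightarrow> \<gamma>' t = \<gamma> t" and t: "t \<in> {c..d}"
  shows "velocity A c d \<gamma>' t = velocity A a b \<gamma> t"
proof (rule velocity_eqI[OF cd(1) t])
  have "a < b" using cd by auto
  fix k assume k: "k \<in> A" "\<gamma>' t \<in> fst k"
  have "(snd k \<circ> \<gamma> has_vector_derivative velocity A a b \<gamma> t k) (at t within {c..d})"
    by (rule has_vector_derivative_within_subset[OF Ck_curve_SucD(1)[OF A \<open>a < b\<close> \<gamma> k(1)] cd(2)])
      (use t cd(2) k(2) eq in auto)
  then show "(snd k \<circ> \<gamma>' has_vector_derivative velocity A a b \<gamma> t k) (at t within {c..d})"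
    by (rule has_vector_derivative_transform[OF t, rotated]) (simp add: eq)
next
  fix k assume "k \<notin> A \<or> \<gamma>' t \<notin> fst k"
  then show "velocity A a b \<gamma> t k = 0" using eq[OF t] by (auto simp: velocity_apply)
qed

lemma C1_curve_subinterval:
  assumes A: "smooth_atlas A" and cd: "c < d" "{c..d} \<subseteq> {a..b}" and \<gamma>: "Ck_curve A 1 a b \<gamma>"
    and eq: "\<And>t. t \<in> {c..d} \<Longrightarrow> \<gamma>' t = \<gamma> t"
  shows "Ck_curve A 1 c d \<gamma>'"
proof -
  have ab: "a < b" using cd by auto
  have \<gamma>1: "Ck_curve A (Suc 0) a b \<gamma>" using \<gamma> by simp
  have "Ck_curve A 1 c d \<gamma>"
  proof (rule C1_curveI[OF A cd(1)])
    show "continuous_on {c..d} \<gamma>"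
      using Ck_curve_continuous_on[OF \<gamma>] cd(2) by (rule continuous_on_subset)
  next
    fix k t assume k: "k \<in> A" and t: "t \<in> {c..d}" "\<gamma> t \<in> fst k"
    show "(snd k \<circ> \<gamma> has_vector_derivative velocity A a b \<gamma> t k) (at t within {c..d})"
      by (rule has_vector_derivative_within_subset[OF Ck_curve_SucD(1)[OF A ab \<gamma>1 k] cd(2)])
        (use t cd(2) in auto)
  next
    fix k assume k: "k \<in> A"
    show "continuous_on ({c..d} \<inter> \<gamma> -` fst k) (\<lambda>t. velocity A a b \<gamma> t k)"
      by (rule continuous_on_subset[OF Ck_curve_SucD(2)[OF A ab \<gamma>1 k, simplified]])
        (use cd(2) in auto)
  qed
  then show ?thesis
    by (rule Ck_curve_cong[THEN iffD1, rotated]) (simp add: eq)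
qed

text \<open>
  On \<open>{a..b}\<close> the velocity comes from the inserted curve, on \<open>R = {l..a} \<union> {b..r}\<close> from
  the old one. The two agree on the overlap \<open>{a, b}\<close>, so derivatives within the two closed parts combine to
  a derivative within \<open>{l..r}\<close>, and pasting along closed sets gives a continuous velocity. The cases
  \<open>l = a\<close> and \<open>b = r\<close> are included: matching at such a point only says that the end data are kept.
\<close>
lemma C1_curve_insert:
  assumes A: "smooth_atlas A" and lr: "l \<le> a" "a < b" "b \<le> r"
    and \<gamma>: "Ck_curve A 1 l r \<gamma>" and \<gamma>': "Ck_curve A 1 a b \<gamma>'"
    and match: "\<And>t. t \<in> {a, b} \<Longrightarrow> \<gamma>' t = \<gamma> t \<and> velocity A a b \<gamma>' t = velocity A l r \<gamma> t"
  shows "Ck_curve A 1 l r (insert_curve a b \<gamma>' \<gamma>)"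
    and "t \<in> {l..r} \<Longrightarrow> velocity A l r (insert_curve a b \<gamma>' \<gamma>) t =
      (if t \<in> {a..b} then velocity A a b \<gamma>' t else velocity A l r \<gamma> t)"
proof -
  define \<beta> where "\<beta> = insert_curve a b \<gamma>' \<gamma>"
  define v where "v t = (if t \<in> {a..b} then velocity A a b \<gamma>' t else velocity A l r \<gamma> t)" for t
  define R where "R = {l..a} \<union> {b..r}"
  have \<beta>_in: "\<beta> t = \<gamma>' t" "v t = velocity A a b \<gamma>' t" if "t \<in> {a..b}" for t
    using that by (simp_all add: \<beta>_def insert_curve_def v_def)
  have \<beta>_out: "\<beta> t = \<gamma> t" "v t = velocity A l r \<gamma> t" if "t \<in> R" for t
    using that lr match[of t] by (auto simp: \<beta>_def insert_curve_def v_def R_def)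
  have "l < r" using lr by simp
  have \<gamma>1: "Ck_curve A (Suc 0) l r \<gamma>" and \<gamma>'1: "Ck_curve A (Suc 0) a b \<gamma>'"
    using \<gamma> \<gamma>' by simp_all
  have cover: "{l..r} = {a..b} \<union> R" using lr by (auto simp: R_def)
  have "closed R" unfolding R_def by (intro closed_Un closed_real_atLeastAtMost)
  have deriv: "(snd c \<circ> \<beta> has_vector_derivative v t c) (at t within {l..r})"
    if c: "c \<in> A" and t: "t \<in> {l..r}" "\<beta> t \<in> fst c" for c t
  proof -
    \<comment> \<open>The sets of the case distinction are disjoint; their closures meet at the junctions only.\<close>
    let ?R = "{l..r} - {a..b}"
    have "closure ?R \<subseteq> R"
      using \<open>closed R\<close> cover by (intro closure_minimal) auto
    then have clo: "closure {a..b} \<inter> closure ?R \<subseteq> {a, b}"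
      using lr by (auto simp: R_def)
    have cloR: "?R \<union> (closure {a..b} \<inter> closure ?R) \<subseteq> R"
      using \<open>closure ?R \<subseteq> R\<close> closure_subset[of ?R] by auto
    have "((\<lambda>s. if s \<in> {a..b} then (snd c \<circ> \<gamma>') s else (snd c \<circ> \<gamma>) s) has_vector_derivative
        (if t \<in> {a..b} then velocity A a b \<gamma>' t c else velocity A l r \<gamma> t c)) (at t within {l..r})"
    proof (rule has_vector_derivative_If_within_closures[where T = "?R"])
      show "t \<in> {a..b} \<union> ?R" "{l..r} = {a..b} \<union> ?R" using t lr by auto
    next
      assume "t \<in> {a..b} \<union> (closure {a..b} \<inter> closure ?R)"
      then have tab: "t \<in> {a..b}" by auto
      show "(snd c \<circ> \<gamma>' has_vector_derivative velocity A a b \<gamma>' t c)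
          (at t within {a..b} \<union> (closure {a..b} \<inter> closure ?R))"
        by (rule has_vector_derivative_within_subset[OF Ck_curve_SucD(1)[OF A lr(2) \<gamma>'1 c tab]])
          (use t \<beta>_in[OF tab] in auto)
    next
      assume "t \<in> ?R \<union> (closure {a..b} \<inter> closure ?R)"
      then have tR: "t \<in> R" using cloR by blast
      show "(snd c \<circ> \<gamma> has_vector_derivative velocity A l r \<gamma> t c)
          (at t within ?R \<union> (closure {a..b} \<inter> closure ?R))"
        by (rule has_vector_derivative_within_subset[OF Ck_curve_SucD(1)[OF A \<open>l < r\<close> \<gamma>1 c t(1)]])
          (use t \<beta>_out[OF tR] cloR cover in auto)
    next
      assume "t \<in> closure {a..b}" "t \<in> closure ?R"
      then have "t \<in> {a, b}" using clo by blast
      then show "(snd c \<circ> \<gamma>') t = (snd c \<circ> \<gamma>) t" "velocity A a b \<gamma>' t c = velocity A l r \<gamma> t c"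
        using match by auto
    qed
    moreover have "snd c \<circ> \<beta> = (\<lambda>s. if s \<in> {a..b} then (snd c \<circ> \<gamma>') s else (snd c \<circ> \<gamma>) s)"
      by (auto simp: \<beta>_def insert_curve_def)
    ultimately show ?thesis
      by (simp only: v_def if_distribR)
  qed
  show "Ck_curve A 1 l r (insert_curve a b \<gamma>' \<gamma>)"
    unfolding \<beta>_def[symmetric]
  proof (rule C1_curveI[OF A \<open>l < r\<close> _ deriv])
    have "continuous_on {a..b} \<beta>"
      by (rule continuous_on_eq[OF Ck_curve_continuous_on[OF \<gamma>']]) (simp add: \<beta>_in)
    moreover have "continuous_on R \<gamma>"
      by (rule continuous_on_subset[OF Ck_curve_continuous_on[OF \<gamma>]]) (simp add: cover)
    then have "continuous_on R \<beta>"
      by (rule continuous_on_eq) (simp add: \<beta>_out)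
    ultimately show "continuous_on {l..r} \<beta>"
      unfolding cover using \<open>closed R\<close> by (intro continuous_on_closed_Un) auto
  next
    fix c assume c: "c \<in> A"
    define Y where "Y = {l..r} \<inter> \<beta> -` fst c"
    have Y: "Y \<inter> {a..b} \<union> Y \<inter> R = Y" using cover by (auto simp: Y_def)
    have "continuous_on (Y \<inter> {a..b}) (\<lambda>t. velocity A a b \<gamma>' t c)"
      by (rule continuous_on_subset[OF Ck_curve_SucD(2)[OF A lr(2) \<gamma>'1 c, simplified]])
        (auto simp: Y_def \<beta>_in)
    then have 1: "continuous_on (Y \<inter> {a..b}) (\<lambda>t. v t c)"
      by (rule continuous_on_eq) (simp add: \<beta>_in)
    have "continuous_on (Y \<inter> R) (\<lambda>t. velocity A l r \<gamma> t c)"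
      by (rule continuous_on_subset[OF Ck_curve_SucD(2)[OF A \<open>l < r\<close> \<gamma>1 c, simplified]])
        (auto simp: Y_def \<beta>_out)
    then have 2: "continuous_on (Y \<inter> R) (\<lambda>t. v t c)"
      by (rule continuous_on_eq) (simp add: \<beta>_out)
    have "closedin (top_of_set Y) (Y \<inter> {a..b})" "closedin (top_of_set Y) (Y \<inter> R)"
      using \<open>closed R\<close> by (auto intro: closedin_closed_Int)
    then have "continuous_on (Y \<inter> {a..b} \<union> Y \<inter> R) (\<lambda>t. v t c)"
      using 1 2 by (intro continuous_on_Un_local) (simp_all only: Y)
    then show "continuous_on ({l..r} \<inter> \<beta> -` fst c) (\<lambda>t. v t c)"
      by (simp only: Y Y_def[symmetric])
  qed
  show "velocity A l r (insert_curve a b \<gamma>' \<gamma>) t =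
      (if t \<in> {a..b} then velocity A a b \<gamma>' t else velocity A l r \<gamma> t)" if t: "t \<in> {l..r}"
    unfolding \<beta>_def[symmetric] v_def[symmetric]
  proof (rule velocity_eqI[OF \<open>l < r\<close> t deriv[OF _ t]])
    show "v t c = 0" if "c \<notin> A \<or> \<beta> t \<notin> fst c" for c
      using that by (auto simp: v_def velocity_apply \<beta>_def insert_curve_def)
  qed
qed

lemma piecewise_smooth_curve_subinterval:
  assumes "piecewise_smooth_curve A a b \<gamma>" and cd: "{c..d} \<subseteq> {a..b}"
    and eq: "\<And>t. t \<in> {c..d} \<Longrightarrow> \<gamma>' t = \<gamma> t"
  shows "piecewise_smooth_curve A c d \<gamma>'"
proof -
  obtain P where P: "finite P"
    "\<And>s t k. a \<le> s \<Longrightarrow> s < t \<Longrightarrow> t \<le> b \<Longrightarrow> {s<..<t} \<inter> P = {} \<Longrightarrow> Ck_curve A k s t \<gamma>"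
    using assms(1) unfolding piecewise_smooth_curve_def by blast
  have "continuous_on {c..d} \<gamma>"
    using assms(1) cd unfolding piecewise_smooth_curve_def by (blast intro: continuous_on_subset)
  then have "continuous_on {c..d} \<gamma>'"
    by (rule continuous_on_eq) (simp add: eq)
  moreover have "Ck_curve A k s t \<gamma>'" if "c \<le> s" "s < t" "t \<le> d" "{s<..<t} \<inter> P = {}" for s t k
  proof -
    have "Ck_curve A k s t \<gamma>"
      by (rule P(2)) (use that cd in auto)
    then show ?thesis
      by (rule Ck_curve_cong[THEN iffD1, rotated]) (use that eq in auto)
  qed
  ultimately show ?thesis
    unfolding piecewise_smooth_curve_def using P(1) by blast
qed

text \<open>
  With \<open>a\<close> and \<open>b\<close> among the break points, every interval without break points lies on one side of the
  junctions.
\<close>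
lemma piecewise_smooth_curve_insert:
  assumes lr: "l \<le> a" "a < b" "b \<le> r"
    and \<gamma>: "piecewise_smooth_curve A l r \<gamma>" and \<gamma>': "piecewise_smooth_curve A a b \<gamma>'"
    and match: "\<gamma>' a = \<gamma> a" "\<gamma>' b = \<gamma> b"
    and cont: "continuous_on {l..r} (insert_curve a b \<gamma>' \<gamma>)"
  shows "piecewise_smooth_curve A l r (insert_curve a b \<gamma>' \<gamma>)"
proof -
  obtain P where P: "finite P"
    "\<And>s t k. l \<le> s \<Longrightarrow> s < t \<Longrightarrow> t \<le> r \<Longrightarrow> {s<..<t} \<inter> P = {} \<Longrightarrow> Ck_curve A k s t \<gamma>"
    using \<gamma> unfolding piecewise_smooth_curve_def by blast
  obtain P' where P': "finite P'"
    "\<And>s t k. a \<le> s \<Longrightarrow> s < t \<Longrightarrow> t \<le> b \<Longrightarrow> {s<..<t} \<inter> P' = {} \<Longrightarrow> Ck_curve A k s t \<gamma>'"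
    using \<gamma>' unfolding piecewise_smooth_curve_def by blast
  have smooth: "Ck_curve A k s t (insert_curve a b \<gamma>' \<gamma>)"
    if st: "l \<le> s" "s < t" "t \<le> r" and disj: "{s<..<t} \<inter> (P \<union> P' \<union> {a, b}) = {}" for s t k
  proof -
    have "a \<notin> {s<..<t}" "b \<notin> {s<..<t}" using disj by blast+
    then consider "a \<le> s \<and> t \<le> b" | "t \<le> a \<or> b \<le> s"
      using st lr by force
    then show ?thesis
    proof cases
      case 1
      have "Ck_curve A k s t \<gamma>'"
        by (rule P'(2)) (use 1 st disj in auto)
      then show ?thesis
        by (rule Ck_curve_cong[THEN iffD1, rotated]) (use 1 in \<open>auto simp: insert_curve_def\<close>)
    next
      case 2
      have "\<gamma> u = insert_curve a b \<gamma>' \<gamma> u" if "u \<in> {s..t}" for u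
      proof -
        have "u \<notin> {a..b} \<or> u = a \<or> u = b" using 2 that by auto
        then show ?thesis using match by (auto simp: insert_curve_def)
      qed
      moreover have "Ck_curve A k s t \<gamma>"
        by (rule P(2)) (use st disj in auto)
      ultimately show ?thesis
        using Ck_curve_cong by blast
    qed
  qed
  have "finite (P \<union> P' \<union> {a, b})" using P(1) P'(1) by simp
  then show ?thesis
    unfolding piecewise_smooth_curve_def
    by (intro conjI cont exI[of _ "P \<union> P' \<union> {a, b}"] allI impI smooth) blast+
qed

section \<open>Continuity of insertion in the \<open>C\<^sup>1\<close> topology\<close>

text \<open>
  A subbasic set with empty \<open>K\<close> contains all \<open>C\<^sup>1\<close> curves.
\<close>
lemma topspace_C1_topology:
  assumes "smooth_atlas A"
  shows "topspace (C1_topology A a b) = {\<gamma> \<in> extensional {a..b}. Ck_curve A 1 a b \<gamma>}"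
proof
  show "topspace (C1_topology A a b) \<subseteq> {\<gamma> \<in> extensional {a..b}. Ck_curve A 1 a b \<gamma>}"
    by (auto simp: C1_topology_def C1_subbasic_def)
  obtain c where "c \<in> A" using assms unfolding smooth_atlas_def by blast
  then have "C1_subbasic A a b \<gamma> c {} 1 \<subseteq> topspace (C1_topology A a b)" if "Ck_curve A 1 a b \<gamma>" for \<gamma>
    unfolding C1_topology_def topology_generated_by_topspace
    by (intro Union_upper CollectI exI[of _ \<gamma>] exI[of _ c] exI[of _ "{}"] exI[of _ 1])
      (use that in simp)
  moreover have "\<gamma> \<in> C1_subbasic A a b \<gamma> c {} 1"
    if "\<gamma> \<in> extensional {a..b}" "Ck_curve A 1 a b \<gamma>" for \<gamma>
    using that by (simp add: C1_subbasic_def)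
  ultimately show "{\<gamma> \<in> extensional {a..b}. Ck_curve A 1 a b \<gamma>} \<subseteq> topspace (C1_topology A a b)"
    by blast
qed

text \<open>
  A subbasic condition on the inserted curve, imposed at the parameters in \<open>K\<close>, splits into two. For
  parameters outside \<open>{a..b}\<close> it concerns the fixed curve \<open>\<gamma>\<close> only, so it either fails for all
  arguments or may be dropped. On \<open>K \<inter> {a..b}\<close> it is a subbasic condition on the argument, centred at
  the restriction of the old centre. Hence preimages of subbasic sets are empty or traces
  of subbasic sets on \<open>B\<close>.
\<close>
lemma continuous_map_insert_curve:
  assumes A: "smooth_atlas A" and lr: "l \<le> a" "a < b" "b \<le> r"
    and \<gamma>: "\<gamma> \<in> extensional {l..r}" "Ck_curve A 1 l r \<gamma>"
    and B: "\<And>\<gamma>' t. \<gamma>' \<in> B \<Longrightarrow> t \<in> {a, b} \<Longrightarrow>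
      \<gamma>' t = \<gamma> t \<and> velocity A a b \<gamma>' t = velocity A l r \<gamma> t"
  shows "continuous_map (subtopology (C1_topology A a b) B) (C1_topology A l r)
    (\<lambda>\<gamma>'. insert_curve a b \<gamma>' \<gamma>)" (is "continuous_map ?X _ ?G")
proof -
  have X: "\<gamma>' \<in> topspace ?X \<longleftrightarrow> \<gamma>' \<in> B \<and> \<gamma>' \<in> extensional {a..b} \<and> Ck_curve A 1 a b \<gamma>'" for \<gamma>'
    using topspace_C1_topology[OF A] by auto
  have G: "?G \<gamma>' \<in> extensional {l..r}" "Ck_curve A 1 l r (?G \<gamma>')"
      "\<And>t. t \<in> {l..r} \<Longrightarrow> velocity A l r (?G \<gamma>') t =
        (if t \<in> {a..b} then velocity A a b \<gamma>' t else velocity A l r \<gamma> t)"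
    if "\<gamma>' \<in> topspace ?X" for \<gamma>'
  proof -
    show "?G \<gamma>' \<in> extensional {l..r}"
      using \<gamma>(1) lr by (auto simp: insert_curve_def extensional_def)
    have \<gamma>': "\<gamma>' \<in> B" "Ck_curve A 1 a b \<gamma>'" using that X by blast+
    show "Ck_curve A 1 l r (?G \<gamma>')"
      by (rule C1_curve_insert(1)[OF A lr \<gamma>(2) \<gamma>'(2) B[OF \<gamma>'(1)]])
    show "velocity A l r (?G \<gamma>') t =
        (if t \<in> {a..b} then velocity A a b \<gamma>' t else velocity A l r \<gamma> t)" if "t \<in> {l..r}" for t
      by (rule C1_curve_insert(2)[OF A lr \<gamma>(2) \<gamma>'(2) B[OF \<gamma>'(1)] that])
  qed
  have "openin ?X (?G -` C1_subbasic A l r \<gamma>0 c K \<epsilon> \<inter> topspace ?X)"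
    if *: "Ck_curve A 1 l r \<gamma>0" "c \<in> A" "compact K" "K \<subseteq> {l..r}" "\<gamma>0 ` K \<subseteq> fst c" "0 < \<epsilon>"
    for \<gamma>0 c K \<epsilon>
  proof -
    define close where "close \<beta> v t \<longleftrightarrow> \<beta> \<in> fst c \<and> norm (snd c \<beta> - snd c (\<gamma>0 t)) < \<epsilon> \<and>
      norm (v c - velocity A l r \<gamma>0 t c) < \<epsilon>" for \<beta> t and v :: "('a, 'b) tangent"
    have pre: "\<gamma>' \<in> ?G -` C1_subbasic A l r \<gamma>0 c K \<epsilon> \<longleftrightarrow>
        (\<forall>t\<in>K. if t \<in> {a..b} then close (\<gamma>' t) (velocity A a b \<gamma>' t) t
          else close (\<gamma> t) (velocity A l r \<gamma> t) t)" if "\<gamma>' \<in> topspace ?X" for \<gamma>'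
    proof -
      have "\<gamma>' \<in> ?G -` C1_subbasic A l r \<gamma>0 c K \<epsilon> \<longleftrightarrow>
          (\<forall>t\<in>K. close (?G \<gamma>' t) (velocity A l r (?G \<gamma>') t) t)"
        using G(1,2)[OF that] by (simp add: C1_subbasic_def close_def)
      also have "\<dots> \<longleftrightarrow> (\<forall>t\<in>K. if t \<in> {a..b} then close (\<gamma>' t) (velocity A a b \<gamma>' t) t
          else close (\<gamma> t) (velocity A l r \<gamma> t) t)"
        using G(3)[OF that] *(4) by (intro ball_cong) (auto simp: insert_curve_def)
      finally show ?thesis .
    qed
    show ?thesis
    proof (cases "\<forall>t\<in>K - {a..b}. close (\<gamma> t) (velocity A l r \<gamma> t) t")
      case False
      then have "?G -` C1_subbasic A l r \<gamma>0 c K \<epsilon> \<inter> topspace ?X = {}"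
        using pre by fastforce
      then show ?thesis by simp
    next
      case True
      let ?\<gamma>0 = "restrict \<gamma>0 {a..b}"
      let ?N = "C1_subbasic A a b ?\<gamma>0 c (K \<inter> {a..b}) \<epsilon>"
      have sub: "{a..b} \<subseteq> {l..r}" using lr by auto
      have \<gamma>0: "Ck_curve A 1 a b ?\<gamma>0"
        by (rule C1_curve_subinterval[OF A lr(2) sub *(1)]) simp
      have vel: "velocity A a b ?\<gamma>0 t = velocity A l r \<gamma>0 t" if "t \<in> {a..b}" for t
        by (rule velocity_subinterval[OF A lr(2) sub, of 0]) (use *(1) that in auto)
      have "openin (C1_topology A a b) ?N"
        unfolding C1_topology_def
      proof (intro topology_generated_by_Basis CollectI exI conjI)
        show "compact (K \<inter> {a..b})" using *(3) by (intro compact_Int) auto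
        show "?\<gamma>0 ` (K \<inter> {a..b}) \<subseteq> fst c" using *(5) by auto
      qed (use * \<gamma>0 in auto)
      moreover have "?G -` C1_subbasic A l r \<gamma>0 c K \<epsilon> \<inter> topspace ?X = ?N \<inter> B"
      proof -
        have "\<gamma>' \<in> ?G -` C1_subbasic A l r \<gamma>0 c K \<epsilon> \<longleftrightarrow> \<gamma>' \<in> ?N" if "\<gamma>' \<in> topspace ?X" for \<gamma>'
        proof -
          have "\<gamma>' \<in> ?N \<longleftrightarrow> (\<forall>t\<in>K \<inter> {a..b}. close (\<gamma>' t) (velocity A a b \<gamma>' t) t)"
            using that X by (auto simp: C1_subbasic_def close_def vel)
          then show ?thesis using pre[OF that] True by auto
        qed
        moreover have "\<gamma>' \<in> topspace ?X" if "\<gamma>' \<in> ?N \<inter> B" for \<gamma>'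
          using that X by (auto simp: C1_subbasic_def)
        ultimately show ?thesis using X by blast
      qed
      ultimately show ?thesis by (auto simp: openin_subtopology)
    qed
  qed
  moreover have "?G ` topspace ?X \<subseteq> topspace (C1_topology A l r)"
    using G(1,2) by (auto simp: topspace_C1_topology[OF A])
  ultimately show ?thesis
    unfolding C1_topology_def[of A l r]
    by (intro continuous_on_generated_topo) (auto simp only: topology_generated_by_topspace)
qed


section \<open>Restrictions of minimizers\<close>

text \<open>
  The middle term may be computed on \<open>{a..b}\<close> because the two integrands differ at most at \<open>a\<close> and \<open>b\<close>,
  where \<open>velocity\<close> may pass from two-sided to one-sided derivatives.
\<close>
lemma J_functional_split:
  assumes "smooth_atlas A" "riemannian_metric A g" "affine_connection A \<Gamma>" "smooth_function A V"
    and lr: "l \<le> a" "a < b" "b \<le> r" and \<gamma>: "piecewise_smooth_curve A l r \<gamma>"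
    and eq: "\<And>t. t \<in> {a..b} \<Longrightarrow> \<gamma> t = \<gamma>' t"
  shows "J_functional A g \<Gamma> V l r \<gamma> = integral {l..a} (lagrangian A g \<Gamma> V l r \<gamma>) +
    J_functional A g \<Gamma> V a b \<gamma>' + integral {b..r} (lagrangian A g \<Gamma> V l r \<gamma>)"
proof -
  let ?L = "lagrangian A g \<Gamma> V l r \<gamma>"
  have int: "?L integrable_on {l..r}"
    using assms by (intro lagrangian_integrable_on) auto
  have "integral {a..b} ?L = integral {a..b} (lagrangian A g \<Gamma> V a b \<gamma>')"
  proof (rule integral_spike[of "{a, b}"])
    show "lagrangian A g \<Gamma> V a b \<gamma>' t = ?L t" if "t \<in> {a..b} - {a, b}" for t
      by (rule lagrangian_local[of "{a<..<b}"]) (use that lr eq in auto)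
  qed auto
  moreover have "integral {l..r} ?L = integral {l..a} ?L + integral {a..r} ?L"
    using lr int by (intro Henstock_Kurzweil_Integration.integral_combine[symmetric]) auto
  moreover have "integral {a..r} ?L = integral {a..b} ?L + integral {b..r} ?L"
    using lr by (intro Henstock_Kurzweil_Integration.integral_combine[symmetric]
        integrable_on_subinterval[OF int]) auto
  ultimately show ?thesis
    by (simp add: J_functional_eq)
qed

theorem proposition3:
  fixes A :: "('q::{t2_space,second_countable_topology}, 'e::euclidean_space) chart set"
    and g :: "'q \<Rightarrow> ('q, 'e) tangent \<Rightarrow> ('q, 'e) tangent \<Rightarrow> real"
    and \<Gamma> :: "('q, 'e) chart \<Rightarrow> 'e \<Rightarrow> 'e \<Rightarrow> 'e \<Rightarrow> 'e"
    and V :: "'q \<Rightarrow> real"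
    and T a b :: real
    and \<xi>0 \<eta>0 :: "'q \<times> ('q, 'e) tangent"
    and q :: "real \<Rightarrow> 'q"
  assumes "complete_connected_riemannian_manifold A g"
    and "levi_civita_connection A g \<Gamma>"
    and "smooth_function A V" and "\<And>p. 0 \<le> V p"
    and "0 < T"
    and "\<xi>0 \<in> tangent_bundle A" and "\<eta>0 \<in> tangent_bundle A"
    and "local_minimizer A g \<Gamma> V 0 T \<xi>0 \<eta>0 q"
    and "{a..b} \<subseteq> {0..T}" and "a < b"
  shows "local_minimizer A g \<Gamma> V a b
           (q a, velocity A 0 T q a) (q b, velocity A 0 T q b) (restrict q {a..b})"
proof -
  have A: "smooth_atlas A" and g: "riemannian_metric A g" and \<Gamma>: "affine_connection A \<Gamma>"
    using assms(1,2)
    unfolding complete_connected_riemannian_manifold_def levi_civita_connection_def by blast+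
  have ab: "0 \<le> a" "a < b" "b \<le> T" using assms(9,10) by auto
  let ?q = "restrict q {a..b}"
  let ?\<Omega> = "admissible A 0 T \<xi>0 \<eta>0"
  let ?\<Omega>' = "admissible A a b (q a, velocity A 0 T q a) (q b, velocity A 0 T q b)"
  let ?G = "\<lambda>\<gamma>'. insert_curve a b \<gamma>' q"
  let ?J = "J_functional A g \<Gamma> V"
  obtain W where q: "q \<in> ?\<Omega>" and W: "openin (subtopology (C1_topology A 0 T) ?\<Omega>) W" "q \<in> W"
    and min: "\<And>\<gamma>. \<gamma> \<in> W \<Longrightarrow> ?J 0 T q \<le> ?J 0 T \<gamma>"
    using assms(8) unfolding local_minimizer_def by blast
  have q': "q \<in> extensional {0..T}" "Ck_curve A 1 0 T q" "piecewise_smooth_curve A 0 T q"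
      "(q 0, velocity A 0 T q 0) = \<xi>0" "(q T, velocity A 0 T q T) = \<eta>0"
    using q by (auto simp: admissible_def)
  have q_adm: "?q \<in> ?\<Omega>'"
  proof -
    have "velocity A a b ?q t = velocity A 0 T q t" if "t \<in> {a..b}" for t
      by (rule velocity_subinterval[OF A ab(2) assms(9), of 0]) (use q'(2) that in auto)
    moreover have "Ck_curve A 1 a b ?q"
      by (rule C1_curve_subinterval[OF A ab(2) assms(9) q'(2)]) simp
    moreover have "piecewise_smooth_curve A a b ?q"
      by (rule piecewise_smooth_curve_subinterval[OF q'(3) assms(9)]) simp
    ultimately show ?thesis
      using ab by (simp add: admissible_def)
  qed
  have adm': "\<gamma>' \<in> extensional {a..b}" "Ck_curve A 1 a b \<gamma>'" "piecewise_smooth_curve A a b \<gamma>'"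
      "\<And>t. t \<in> {a, b} \<Longrightarrow> \<gamma>' t = q t \<and> velocity A a b \<gamma>' t = velocity A 0 T q t"
    if "\<gamma>' \<in> ?\<Omega>'" for \<gamma>'
    using that by (auto simp: admissible_def)
  \<comment> \<open>At \<open>0\<close> and \<open>T\<close> the data of \<open>q\<close> survive also if \<open>a = 0\<close> or \<open>b = T\<close>, by the matching at \<open>a\<close> and \<open>b\<close>.\<close>
  have G_adm: "?G \<gamma>' \<in> ?\<Omega>" if \<gamma>': "\<gamma>' \<in> ?\<Omega>'" for \<gamma>'
  proof -
    note C1 = C1_curve_insert[OF A ab q'(2) adm'(2,4)[OF \<gamma>']]
    have "?G \<gamma>' \<in> extensional {0..T}"
      using q'(1) ab by (auto simp: insert_curve_def extensional_def)
    moreover have "piecewise_smooth_curve A 0 T (?G \<gamma>')"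
      using adm'(4)[OF \<gamma>']
      by (intro piecewise_smooth_curve_insert ab q'(3) adm'(3)[OF \<gamma>'] Ck_curve_continuous_on[OF C1(1)])
        auto
    moreover have "?G \<gamma>' t = q t \<and> velocity A 0 T (?G \<gamma>') t = velocity A 0 T q t" if "t \<in> {0, T}" for t
    proof -
      have "t \<in> {0..T}" and "t \<in> {a..b} \<Longrightarrow> t \<in> {a, b}" using that ab assms(5) by auto
      then show ?thesis
        using C1(2)[of t] adm'(4)[OF \<gamma>', of t] by (auto simp: insert_curve_def)
    qed
    ultimately show ?thesis
      using C1(1) q'(4,5) by (auto simp: admissible_def)
  qed
  let ?X = "subtopology (C1_topology A a b) ?\<Omega>'"
  have "continuous_map ?X (subtopology (C1_topology A 0 T) ?\<Omega>) ?G"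
    unfolding continuous_map_in_subtopology
    using continuous_map_insert_curve[OF A ab q'(1,2) adm'(4)] G_adm by auto
  then have "openin ?X {\<gamma>' \<in> topspace ?X. ?G \<gamma>' \<in> W}"
    using W(1) by (rule openin_continuous_map_preimage)
  moreover have "?q \<in> {\<gamma>' \<in> topspace ?X. ?G \<gamma>' \<in> W}"
    using q_adm adm'(1,2)[OF q_adm] W(2) by (simp add: topspace_C1_topology[OF A] insert_curve_restrict)
  moreover have "?J a b ?q \<le> ?J a b \<gamma>'" if "\<gamma>' \<in> topspace ?X" "?G \<gamma>' \<in> W" for \<gamma>'
  proof -
    have \<gamma>': "\<gamma>' \<in> ?\<Omega>'" using that(1) by simp
    let ?L = "lagrangian A g \<Gamma> V 0 T"
    have "?J 0 T q = integral {0..a} (?L q) + ?J a b ?q + integral {b..T} (?L q)"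
      by (rule J_functional_split[OF A g \<Gamma> assms(3) ab q'(3)]) simp
    moreover have "?J 0 T (?G \<gamma>') =
        integral {0..a} (?L (?G \<gamma>')) + ?J a b \<gamma>' + integral {b..T} (?L (?G \<gamma>'))"
      by (rule J_functional_split[OF A g \<Gamma> assms(3) ab])
        (use G_adm[OF \<gamma>'] in \<open>auto simp: admissible_def insert_curve_def\<close>)
    moreover have "integral {0..a} (?L q) = integral {0..a} (?L (?G \<gamma>'))"
    proof (rule integral_spike[of "{0, a}"])
      show "?L (?G \<gamma>') t = ?L q t" if "t \<in> {0..a} - {0, a}" for t
        by (rule lagrangian_local[of "{0<..<a}"]) (use that ab in \<open>auto simp: insert_curve_def\<close>)
    qed auto
    moreover have "integral {b..T} (?L q) = integral {b..T} (?L (?G \<gamma>'))"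
    proof (rule integral_spike[of "{b, T}"])
      show "?L (?G \<gamma>') t = ?L q t" if "t \<in> {b..T} - {b, T}" for t
        by (rule lagrangian_local[of "{b<..<T}"]) (use that ab in \<open>auto simp: insert_curve_def\<close>)
    qed auto
    ultimately show ?thesis
      using min[OF that(2)] by linarith
  qed
  ultimately show ?thesis
    unfolding local_minimizer_def using q_adm by blast
qed

end
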